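(* Let $q$ be a prime power, let $\mathbb{F}_q$ be the finite field with $q$ elements, and let $b\geq 1$ be an integer. Then, as formal power series in $t$, $$\sum_{n\geq 0} \frac{\#\{(A,B)\in \mathrm{Mat}_n(\mathbb{F}_q)^2: AB=BA,\ A^b B=0\}}{|\mathrm{GL}_n(\mathbb{F}_q)|}\, t^n = \frac{1}{(t;q^{-1})_\infty \prod_{i=1}^b (t^i;q^{-1})_\infty}\sum_{k=0}^\infty \frac{q^{-k^2} t^{(b+1)k}}{(q^{-1};q^{-1})_k}\, (tq^{-(k+1)};q^{-1})_\infty .$$
   Context: Notation: $(a;p)_n=(1-a)(1-ap)\cdots(1-ap^{n-1})$ for $n\ge 0$ and $(a;p)_\infty=\prod_{i\geq 0}(1-ap^i)$. Here $p=q^{-1}$, and infinite products are read as power series in $t$ whose coefficients are convergent (real) numbers. The $n=0$ term of the left-hand side is $1$. *)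

theory Defs
  imports
    "HOL-Computational_Algebra.Computational_Algebra"
    "HOL-Number_Theory.Number_Theory"
    "HOL-Analysis.Analysis"
    "Jordan_Normal_Form.Matrix"
begin

definition commuting_nil_pairs :: "nat \<Rightarrow> nat \<Rightarrow> ('a::field mat \<times> 'a mat) set" where
  "commuting_nil_pairs b n =
     {(A, B). A \<in> carrier_mat n n \<and> B \<in> carrier_mat n n \<and> A * B = B * A \<and>
              (A ^\<^sub>m b) * B = 0\<^sub>m n n}"

definition GL_mat :: "nat \<Rightarrow> 'a::field mat set" where
  "GL_mat n = {A \<in> carrier_mat n n. invertible_mat A}"

definition qpoch :: "'a::comm_ring_1 \<Rightarrow> 'a \<Rightarrow> nat \<Rightarrow> 'a" where
  "qpoch a p n = (\<Prod>i<n. 1 - a * p ^ i)"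

(* The library topology on formal power series is the t-adic one, in which the partial
   products of (t;p)_inf for real p with 0 < p < 1 do not converge.  The infinite product is
   therefore the coefficientwise limit in the reals; the limits exist by
   qpoch_inf_coeff_convergent below. *)
definition qpoch_inf :: "real fps \<Rightarrow> real \<Rightarrow> real fps" where
  "qpoch_inf a p = Abs_fps (\<lambda>m. lim (\<lambda>N. fps_nth (qpoch a (fps_const p) N) m))"

lemma qpoch_inf_coeff_convergent:
  fixes a :: "real fps" and p :: real
  assumes p: "\<bar>p\<bar> < 1" and a: "fps_nth a 0 = 0"
  shows "convergent (\<lambda>N. fps_nth (qpoch a (fps_const p) N) m)"
proof (induction m rule: less_induct)
  case (less m)
  let ?c = "\<lambda>N m. fps_nth (qpoch a (fps_const p) N) m"
  define s where "s N = (\<Sum>j=1..m. fps_nth a j * ?c N (m - j))" for N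
  have step: "?c (Suc N) m - ?c N m = - (p ^ N * s N)" for N
  proof -
    have "qpoch a (fps_const p) (Suc N) =
          qpoch a (fps_const p) N - fps_const (p ^ N) * (a * qpoch a (fps_const p) N)"
      by (simp add: qpoch_def algebra_simps fps_const_power)
    hence "?c (Suc N) m = ?c N m - p ^ N * fps_nth (a * qpoch a (fps_const p) N) m"
      by simp
    also have "fps_nth (a * qpoch a (fps_const p) N) m = s N"
      using a by (simp add: fps_mult_nth s_def sum.atLeast_Suc_atMost)
    finally show ?thesis by simp
  qed
  have "convergent s"
    unfolding s_def using less
    by (intro convergent_sum convergent_mult convergent_const) auto
  hence "Bseq s" by (rule convergent_imp_Bseq)
  then obtain K where K: "\<And>N. norm (s N) \<le> K" by (auto simp: Bseq_def)
  have "summable (\<lambda>N. - (p ^ N * s N))"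
  proof (rule summable_comparison_test')
    show "summable (\<lambda>N. K * \<bar>p\<bar> ^ N)"
      using p by (intro summable_mult summable_geometric) simp
    show "norm (- (p ^ N * s N)) \<le> K * \<bar>p\<bar> ^ N" if "N \<ge> 0" for N
      using mult_left_mono[OF K[of N], of "\<bar>p\<bar> ^ N"]
      by (simp add: abs_mult power_abs mult.commute)
  qed
  hence "summable (\<lambda>N. ?c (Suc N) m - ?c N m)"
    by (simp add: step)
  hence "convergent (\<lambda>N. \<Sum>i<N. ?c (Suc i) m - ?c i m)"
    by (simp add: summable_iff_convergent)
  hence "convergent (\<lambda>N. ?c N m - ?c 0 m)"
    by (subst (asm) sum_lessThan_telescope)
  hence "convergent (\<lambda>N. (?c N m - ?c 0 m) + ?c 0 m)"
    by (intro convergent_add convergent_const)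
  thus ?case by simp
qed

lemma summable_fps_X_power_mult:
  fixes c :: "nat \<Rightarrow> real" and g :: "nat \<Rightarrow> real fps"
  shows "summable (\<lambda>k. fps_const (c k) * fps_X ^ ((b + 1) * k) * g k)"
proof -
  let ?f = "\<lambda>k. fps_const (c k) * fps_X ^ ((b + 1) * k) * g k"
  have zero: "fps_nth (?f k) m = 0" if "m < k" for k m
  proof -
    have "m < (b + 1) * k" using that by simp
    thus ?thesis by (simp add: mult.assoc fps_X_power_mult_nth)
  qed
  have "(\<lambda>n. \<Sum>k<n. ?f k) \<longlonglongrightarrow> Abs_fps (\<lambda>m. fps_nth (\<Sum>k<Suc m. ?f k) m)"
  proof (rule tendsto_fpsI)
    fix m
    have "fps_nth (\<Sum>k<n. ?f k) m = fps_nth (\<Sum>k<Suc m. ?f k) m" if "n \<ge> Suc m" for n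
      unfolding fps_sum_nth using that by (intro sum.mono_neutral_right ballI zero) auto
    thus "\<forall>\<^sub>F n in sequentially. fps_nth (\<Sum>k<n. ?f k) m =
            fps_nth (Abs_fps (\<lambda>m. fps_nth (\<Sum>k<Suc m. ?f k) m)) m"
      by (intro eventually_sequentiallyI[of "Suc m"]) simp
  qed
  thus ?thesis by (auto simp: summable_def sums_def)
qed

end

theory Submission
  imports Defs "Jordan_Normal_Form.Determinant"
begin

text \<open>
  For a square matrix \<open>A\<close> let \<open>h b A\<close> be the number of \<open>B\<close> with \<open>A B = B A\<close> and \<open>A^b B = 0\<close>. If \<open>A\<close> has
  size \<open>n\<close> and rank \<open>m\<close>, write \<open>A = P Q\<close> with \<open>P\<close> injective and \<open>Q\<close> surjective; then \<open>Q P\<close> is the matrix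
  of the restriction of \<open>A\<close> to its image. Restricting \<open>B\<close> to the image of \<open>A\<close> as well gives
  \<open>h (b + 1) (P Q) = q^((n - m)^2) h b (Q P)\<close> (\<open>card_annihilated_commutants_Suc\<close>). For fixed \<open>P\<close>, the
  number of \<open>Q\<close> for which \<open>Q P\<close> is a given matrix depends only on the rank \<open>r\<close> of that matrix
  and on \<open>m\<close> and \<open>n\<close> (\<open>card_right_invertible_extensions\<close>).

  Let \<open>H b m d\<close> be the sum of \<open>h b A\<close> over the matrices \<open>A\<close> of size \<open>m + d\<close> and rank \<open>m\<close>, divided by
  the order of the general linear group of degree \<open>m + d\<close>. Write \<open>(p)_j\<close> for \<open>(p; p)_j\<close>. With
  \<open>p = 1 / q\<close> the above becomes the convolution (\<open>rank_weight_recursion\<close>)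
  \<open>H (b + 1) m d = (\<Sum>e\<le>min m d. H b (m - e) e / (p)_(d - e))\<close>. For the series
  \<open>F b k = (\<Sum>m d. H b m d t^(m + k d))\<close> it says \<open>F (b + 1) k = F b (k + 1) / (t^k; p)_\<infinity>\<close>, because
  \<open>(\<Sum>j. x^j / (p)_j) = 1 / (x; p)_\<infinity>\<close>. Hence the left-hand side of the theorem, which is \<open>F b 1\<close>, equals
  \<open>F 0 (b + 1)\<close> divided by the product of the \<open>(t^i; p)_\<infinity>\<close> for \<open>1 \<le> i \<le> b\<close>.

  Finally \<open>h 0 A = 1\<close>, so \<open>H 0\<close> only counts matrices of given rank:
  \<open>H 0 m d = p^(d^2) (p)_(m + d) / ((p)_d^2 (p)_m)\<close>. By the \<open>q\<close>-binomial theorem, the sum of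
  \<open>t^m (p)_(m + d) / ((p)_d (p)_m)\<close> over \<open>m\<close> is \<open>1 / (t; p)_(d + 1) = (t p^(d + 1); p)_\<infinity> / (t; p)_\<infinity>\<close>,
  and the remaining sum over \<open>d\<close> is the sum over \<open>k\<close> in the theorem (\<open>suminf_eq_diag_series\<close>).

  Rank is handled through one-sided inverses instead of subspaces, so that all bijections are given
  by explicit matrix formulas.
\<close>

section \<open>Arithmetic of rectangular matrices and direct sum decompositions\<close>

text \<open>
  Membership in \<open>carrier_mat\<close> is reduced to the two dimension equations, and the laws of matrix
  arithmetic are stated with dimension equations as premises. The simplifier can then normalize
  products of rectangular matrices. Library simp rules with membership premises are removed: most of
  them have a dimension that occurs only in the premises, which can make the simplifier loop once
  membership is rewritten.
\<close>
lemma mat_carrier_iff: "X \<in> carrier_mat a b \<longleftrightarrow> dim_row X = a \<and> dim_col X = b"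
  by auto

declare carrier_matD [simp del] assoc_mult_mat [simp del] mat_carrier_iff [simp]
  mult_carrier_mat [simp del] add_carrier_mat [simp del]
  left_add_zero_mat [simp del] right_add_zero_mat [simp del] right_mult_zero_mat [simp del]
  left_mult_zero_mat [simp del] right_mult_one_mat [simp del]

lemma mat_mult_assoc:
  "dim_col A = dim_row B \<Longrightarrow> dim_col B = dim_row C \<Longrightarrow> A * B * C = A * (B * (C :: 'a::field mat))"
  by (rule assoc_mult_mat[of A "dim_row A" "dim_col A" B "dim_col B" C "dim_col C"]) auto

lemma mat_add_mult:
  "dim_row A = dim_row B \<Longrightarrow> dim_col A = dim_col B \<Longrightarrow> dim_col A = dim_row C \<Longrightarrow>
   (A + B) * C = A * C + B * (C :: 'a::field mat)"
  by (rule add_mult_distrib_mat[of A "dim_row A" "dim_col A" B C "dim_col C"]) auto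

lemma mat_mult_add:
  "dim_row B = dim_row C \<Longrightarrow> dim_col B = dim_col C \<Longrightarrow> dim_col A = dim_row C \<Longrightarrow>
   A * (B + C) = A * B + A * (C :: 'a::field mat)"
  by (rule mult_add_distrib_mat[of A "dim_row A" "dim_col A" B "dim_col B" C]) auto

lemma mat_diff_mult:
  "dim_row A = dim_row B \<Longrightarrow> dim_col A = dim_col B \<Longrightarrow> dim_col A = dim_row C \<Longrightarrow>
   (A - B) * C = A * C - B * (C :: 'a::field mat)"
  by (rule minus_mult_distrib_mat[of A "dim_row A" "dim_col A" B C "dim_col C"]) auto

lemma mat_mult_diff:
  "dim_row B = dim_row C \<Longrightarrow> dim_col B = dim_col C \<Longrightarrow> dim_col A = dim_row C \<Longrightarrow>
   A * (B - C) = A * B - A * (C :: 'a::field mat)"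
  by (rule mult_minus_distrib_mat[of A "dim_row A" "dim_col A" B "dim_col B" C]) auto

lemma mat_zero_mult: "n = dim_row (A :: 'a::field mat) \<Longrightarrow> 0\<^sub>m m n * A = 0\<^sub>m m (dim_col A)"
  by simp

lemma mat_mult_zero: "dim_col (A :: 'a::field mat) = n \<Longrightarrow> A * 0\<^sub>m n m = 0\<^sub>m (dim_row A) m"
  by (simp add: right_mult_zero_mat[of A "dim_row A"])

lemma mat_add_zero: 
  "dim_row (A :: 'a::field mat) = n \<Longrightarrow> dim_col A = m \<Longrightarrow> A + 0\<^sub>m n m = A"
  "dim_row (A :: 'a::field mat) = n \<Longrightarrow> dim_col A = m \<Longrightarrow> 0\<^sub>m n m + A = A"
  "dim_row (A :: 'a::field mat) = n \<Longrightarrow> dim_col A = m \<Longrightarrow> A - 0\<^sub>m n m = A"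
  "dim_row (A :: 'a::field mat) = n \<Longrightarrow> dim_col A = m \<Longrightarrow> A - A = 0\<^sub>m n m"
  by (auto intro!: eq_matI)

lemma mat_one_mult: 
  "dim_row (A :: 'a::field mat) = n \<Longrightarrow> 1\<^sub>m n * A = A"
  "dim_col (A :: 'a::field mat) = n \<Longrightarrow> A * 1\<^sub>m n = A"
  by simp_all

lemmas mat_simps = mat_mult_assoc mat_add_mult mat_mult_add mat_diff_mult mat_mult_diff
  mat_zero_mult mat_mult_zero mat_add_zero mat_one_mult

text \<open>
  Products are normalized to the right, so an equation \<open>A * B = C\<close> also has to be
  applicable inside \<open>A * (B * X)\<close>.
\<close>
lemma mat_head_rewrite:
  "A * B = C \<Longrightarrow> dim_col A = dim_row B \<Longrightarrow> dim_col B = dim_row X \<Longrightarrow>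
   A * (B * X) = C * (X :: 'a::field mat)"
  by (metis mat_mult_assoc)

text \<open>
  A decomposition of the column space \<open>F\<^sup>n\<close> as a direct sum of copies of \<open>F\<^sup>m\<close> and \<open>F\<^sup>k\<close>:
  \<open>P\<close> and \<open>P'\<close> are the injections, \<open>L\<close> and \<open>L'\<close> the projections. Over a finite field this forces
  \<open>n = m + k\<close>, which is derived below by counting vectors.
\<close>
locale mat_splitting =
  fixes n m k :: nat and P L P' L' :: "'a::field mat"
  assumes P: "P \<in> carrier_mat n m" and L: "L \<in> carrier_mat m n"
    and P': "P' \<in> carrier_mat n k" and L': "L' \<in> carrier_mat k n"
    and LP: "L * P = 1\<^sub>m m" and L'P': "L' * P' = 1\<^sub>m k"
    and LP': "L * P' = 0\<^sub>m m k" and L'P: "L' * P = 0\<^sub>m k m"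
    and decomposition: "P * L + P' * L' = 1\<^sub>m n"
begin

lemma dims: "dim_row P = n" "dim_col P = m" "dim_row L = m" "dim_col L = n"
  "dim_row P' = n" "dim_col P' = k" "dim_row L' = k" "dim_col L' = n"
  using P L P' L' by auto

lemma heads:
  "dim_row X = m \<Longrightarrow> L * (P * X) = X"
  "dim_row X = k \<Longrightarrow> L' * (P' * X) = X"
  "dim_row X = k \<Longrightarrow> L * (P' * X) = 0\<^sub>m m (dim_col X)"
  "dim_row X = m \<Longrightarrow> L' * (P * X) = 0\<^sub>m k (dim_col X)"
  by (simp_all add: mat_head_rewrite[OF LP] mat_head_rewrite[OF L'P'] mat_head_rewrite[OF LP']
      mat_head_rewrite[OF L'P] dims)

lemmas rules = dims heads LP L'P' LP' L'P mat_simps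

lemma rows_decomp: "dim_row X = n \<Longrightarrow> P * (L * X) + P' * (L' * X) = X"
proof -
  assume X: "dim_row X = n"
  have "(P * L + P' * L') * X = X" using X by (simp add: decomposition)
  thus ?thesis using X by (simp add: mat_simps dims)
qed

lemma cols_decomp: "dim_col X = n \<Longrightarrow> X * (P * L) + X * (P' * L') = X"
proof -
  assume X: "dim_col X = n"
  have "X * (P * L + P' * L') = X" using X by (simp add: decomposition)
  thus ?thesis using X by (simp add: mat_simps dims)
qed

lemma bij_rows:
  "bij_betw (\<lambda>X. (L * X, L' * X)) (carrier_mat n a) (carrier_mat m a \<times> carrier_mat k a)"
proof (rule bij_betwI[where g = "\<lambda>(Y, Z). P * Y + P' * Z"])
  show "(\<lambda>X. (L * X, L' * X)) \<in> carrier_mat n a \<rightarrow> carrier_mat m a \<times> carrier_mat k a"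
    using L L' by auto
  show "(\<lambda>(Y, Z). P * Y + P' * Z) \<in> carrier_mat m a \<times> carrier_mat k a \<rightarrow> carrier_mat n a"
    using P P' by auto
qed (clarsimp simp: rules rows_decomp)+

end

text \<open>
  Splitting off the last coordinate. With this decomposition \<open>M * S\<close> and \<open>M * e\<close> are the initial
  columns and the last column of \<open>M\<close>, and \<open>P * T + v * f\<close> is \<open>P\<close> with the column \<open>v\<close> appended.
\<close>
lemma last_coordinate_splitting:
  "\<exists>S T e f. mat_splitting (Suc m) m 1 S T e (f :: 'a::field mat)"
proof -
  define S :: "'a mat" where "S = Matrix.mat (Suc m) m (\<lambda>(i,j). if i = j then 1 else 0)"
  define T :: "'a mat" where "T = Matrix.mat m (Suc m) (\<lambda>(i,j). if i = j then 1 else 0)"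
  define e :: "'a mat" where "e = Matrix.mat (Suc m) 1 (\<lambda>(i,j). if i = m then 1 else 0)"
  define f :: "'a mat" where "f = Matrix.mat 1 (Suc m) (\<lambda>(i,j). if j = m then 1 else 0)"
  have if_mult: "(if b then 1 else 0) * x = (if b then x else (0::'a))" for b x by simp
  have "mat_splitting (Suc m) m 1 S T e f"
    by unfold_locales
      (auto intro!: eq_matI simp: S_def T_def e_def f_def scalar_prod_def if_mult)
  thus ?thesis by blast
qed

section \<open>One-sided inverses and rank factorization\<close>

lemma finite_card_carrier_mat:
  "finite (carrier_mat n m :: 'a::finite mat set) \<and>
   card (carrier_mat n m :: 'a mat set) = CARD('a) ^ (n * m)"
proof -
  let ?I = "{..<n} \<times> {..<m}"
  have bij: "bij_betw (Matrix.mat n m) (PiE ?I (\<lambda>_. UNIV :: 'a set)) (carrier_mat n m)"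
  proof (rule bij_betwI[where g = "\<lambda>A. restrict (\<lambda>ij. A $$ ij) ?I"])
    fix f :: "nat \<times> nat \<Rightarrow> 'a" assume "f \<in> PiE ?I (\<lambda>_. UNIV)"
    thus "restrict (\<lambda>ij. Matrix.mat n m f $$ ij) ?I = f"
      by (auto simp: fun_eq_iff PiE_def extensional_def)
  qed (auto intro!: eq_matI)
  have "finite (PiE ?I (\<lambda>_. UNIV :: 'a set))"
    by (intro finite_PiE) auto
  moreover have "card (PiE ?I (\<lambda>_. UNIV :: 'a set)) = CARD('a) ^ (n * m)"
    by (simp add: card_PiE)
  ultimately show ?thesis
    using bij_betw_finite[OF bij] bij_betw_same_card[OF bij] by simp
qed

lemma finite_carrier_mat [simp]: "finite (carrier_mat n m :: 'a::finite mat set)"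
  and card_carrier_mat: "card (carrier_mat n m :: 'a::finite mat set) = CARD('a) ^ (n * m)"
  using finite_card_carrier_mat by blast+

lemma two_le_card_field: "CARD('a::{field,finite}) \<ge> 2"
proof -
  have "card {0, 1 :: 'a} \<le> CARD('a)" by (intro card_mono) auto
  thus ?thesis by simp
qed

lemma mat_splitting_dim:
  assumes "mat_splitting n m k P L P' (L' :: 'a::{field,finite} mat)"
  shows "n = m + k"
proof -
  interpret mat_splitting n m k P L P' L' by fact
  have "CARD('a) ^ n = CARD('a) ^ (m + k)"
    using bij_betw_same_card[OF bij_rows[of 1]]
    by (simp add: card_cartesian_product card_carrier_mat power_add)
  thus ?thesis using two_le_card_field[where ?'a = 'a] by (simp add: power_inject_exp)
qed

text \<open>
  The \<open>n\<close> by \<open>m\<close> matrices that define injective maps \<open>F\<^sup>m \<rightarrow> F\<^sup>n\<close>.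
\<close>
definition left_invertible :: "nat \<Rightarrow> nat \<Rightarrow> 'a::field mat set" where
  "left_invertible n m = {P \<in> carrier_mat n m. \<exists>L \<in> carrier_mat m n. L * P = 1\<^sub>m m}"

text \<open>
  The \<open>m\<close> by \<open>n\<close> matrices that define surjective maps \<open>F\<^sup>n \<rightarrow> F\<^sup>m\<close>.
\<close>
definition right_invertible :: "nat \<Rightarrow> nat \<Rightarrow> 'a::field mat set" where
  "right_invertible m n = {Q \<in> carrier_mat m n. \<exists>R \<in> carrier_mat n m. Q * R = 1\<^sub>m m}"

lemma left_invertibleI:
  "P \<in> carrier_mat n m \<Longrightarrow> L \<in> carrier_mat m n \<Longrightarrow> L * P = 1\<^sub>m m \<Longrightarrow> P \<in> left_invertible n m"
  by (auto simp: left_invertible_def simp del: mat_carrier_iff)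

lemma right_invertibleI:
  "Q \<in> carrier_mat m n \<Longrightarrow> R \<in> carrier_mat n m \<Longrightarrow> Q * R = 1\<^sub>m m \<Longrightarrow> Q \<in> right_invertible m n"
  by (auto simp: right_invertible_def simp del: mat_carrier_iff)

lemma left_invertibleE:
  assumes "P \<in> left_invertible n m"
  obtains L where "P \<in> carrier_mat n m" "L \<in> carrier_mat m n" "L * P = 1\<^sub>m m"
  using assms by (auto simp: left_invertible_def)

lemma right_invertibleE:
  assumes "Q \<in> right_invertible m n"
  obtains R where "Q \<in> carrier_mat m n" "R \<in> carrier_mat n m" "Q * R = 1\<^sub>m m"
  using assms by (auto simp: right_invertible_def)

lemma nonzero_column_functional:
  assumes u: "u \<in> carrier_mat n 1" "u \<noteq> (0\<^sub>m n 1 :: 'a::field mat)"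
  shows "\<exists>l \<in> carrier_mat 1 n. l * u = 1\<^sub>m 1"
proof -
  obtain i where i: "i < n" "u $$ (i, 0) \<noteq> 0"
  proof (rule ccontr)
    assume "\<not> thesis"
    hence "\<And>i. i < n \<Longrightarrow> u $$ (i, 0) = 0" using that by blast
    hence "u = 0\<^sub>m n 1" using u(1) by (intro eq_matI) auto
    thus False using u(2) by simp
  qed
  define l where "l = Matrix.mat 1 n (\<lambda>(_, j). if j = i then inverse (u $$ (i, 0)) else 0)"
  have "l * u = 1\<^sub>m 1"
  proof (rule eq_matI)
    fix a b assume "a < dim_row (1\<^sub>m 1 :: 'a mat)" "b < dim_col (1\<^sub>m 1 :: 'a mat)"
    hence ab: "a = 0" "b = 0" by auto
    have "(l * u) $$ (0, 0) =
            (\<Sum>j = 0..<n. (if j = i then inverse (u $$ (i, 0)) else 0) * u $$ (j, 0))"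
      using u(1) by (simp add: l_def scalar_prod_def)
    also have "\<dots> = (\<Sum>j = 0..<n. if j = i then 1 else 0)"
      using i(2) by (intro sum.cong) auto
    finally show "(l * u) $$ (a, b) = 1\<^sub>m 1 $$ (a, b)" using i(1) by (simp add: ab)
  qed (use u(1) in \<open>auto simp: l_def\<close>)
  thus ?thesis by (intro bexI[of _ l]) (auto simp: l_def)
qed

lemma mat_eq_iff_diff_zero:
  assumes "A \<in> carrier_mat n m" "B \<in> carrier_mat n m"
  shows "A - B = 0\<^sub>m n m \<longleftrightarrow> A = (B :: 'a::field mat)"
proof
  assume *: "A - B = 0\<^sub>m n m"
  show "A = B"
  proof (rule eq_matI)
    fix i j assume ij: "i < dim_row B" "j < dim_col B"
    have "(A - B) $$ (i, j) = 0\<^sub>m n m $$ (i, j)" by (simp only: *)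
    thus "A $$ (i, j) = B $$ (i, j)" using ij assms by simp
  qed (use assms in auto)
qed (use assms in auto)

text \<open>
  Appending a column outside the column space keeps the columns independent.
\<close>
lemma left_invertible_append:
  assumes split: "mat_splitting (Suc m) m 1 S T e (f :: 'a::field mat)"
    and P: "P \<in> left_invertible n m" and v: "v \<in> carrier_mat n 1"
    and new: "\<And>w. w \<in> carrier_mat m 1 \<Longrightarrow> P * w \<noteq> v"
  shows "P * T + v * f \<in> left_invertible n (Suc m)"
proof -
  interpret s: mat_splitting "Suc m" m 1 S T e f by (rule split)
  obtain L where P: "P \<in> carrier_mat n m" and L: "L \<in> carrier_mat m n" and LP: "L * P = 1\<^sub>m m"
    using P by (rule left_invertibleE)
  note d [simp] = carrier_matD[OF P] carrier_matD[OF L] carrier_matD[OF v]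
  \<comment> \<open>the component of \<open>v\<close> outside the column space of \<open>P\<close>; a row \<open>l\<close> that kills \<open>P\<close> and sends
      \<open>v\<close> to 1 is the new last row of the left inverse\<close>
  define u where "u = v - P * (L * v)"
  have u: "u \<in> carrier_mat n 1" by (simp add: u_def)
  have "u \<noteq> 0\<^sub>m n 1"
    using new[of "L * v"] mat_eq_iff_diff_zero[of v n 1 "P * (L * v)"] v
    by (auto simp: u_def)
  then obtain l0 where l0: "l0 \<in> carrier_mat 1 n" "l0 * u = 1\<^sub>m 1"
    using nonzero_column_functional[OF u] by blast
  note d0 [simp] = carrier_matD[OF l0(1)]
  define l where "l = l0 - l0 * (P * L)"
  have l: "l \<in> carrier_mat 1 n" by (simp add: l_def)
  note dl [simp] = carrier_matD[OF l]
  have lP: "l * P = 0\<^sub>m 1 m" by (simp add: l_def mat_simps LP)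
  have lv: "l * v = 1\<^sub>m 1" using l0(2) by (simp add: l_def mat_simps u_def)
  define K where "K = S * (L - L * (v * l)) + e * l"
  have K: "K \<in> carrier_mat (Suc m) n" by (simp add: K_def s.rules)
  have "K * (P * T + v * f) = S * T + e * f"
    by (simp add: K_def s.rules lP lv LP mat_head_rewrite[OF LP] mat_head_rewrite[OF lP]
       mat_head_rewrite[OF lv])
  hence "K * (P * T + v * f) = 1\<^sub>m (Suc m)" by (simp add: s.decomposition)
  moreover have "P * T + v * f \<in> carrier_mat n (Suc m)"
    by (simp add: s.rules)
  ultimately show ?thesis using K by (auto simp: left_invertible_def)
qed

lemma left_invertible_restrict:
  assumes split: "mat_splitting (Suc m) m 1 S T e (f :: 'a::field mat)"
    and M: "M \<in> left_invertible n (Suc m)"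
  shows "M * S \<in> left_invertible n m" "w \<in> carrier_mat m 1 \<Longrightarrow> M * S * w \<noteq> M * e"
proof -
  interpret s: mat_splitting "Suc m" m 1 S T e f by (rule split)
  obtain K where M: "M \<in> carrier_mat n (Suc m)" and K: "K \<in> carrier_mat (Suc m) n" 
    and KM: "K * M = 1\<^sub>m (Suc m)"
    using M by (rule left_invertibleE)
  note d [simp] = carrier_matD[OF M] carrier_matD[OF K]
  have "(T * K) * (M * S) = 1\<^sub>m m" by (simp add: s.rules mat_head_rewrite[OF KM])
  thus "M * S \<in> left_invertible n m"
    by (intro left_invertibleI[where L = "T * K"]) (simp_all add: s.rules)
  show "M * S * w \<noteq> M * e" if w: "w \<in> carrier_mat m 1"
  proof
    assume "M * S * w = M * e"
    hence "(f * K) * (M * S * w) = (f * K) * (M * e)" by simp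
    hence "0\<^sub>m 1 1 = (1\<^sub>m 1 :: 'a mat)" using w by (simp add: s.rules mat_head_rewrite[OF KM])
    hence "0\<^sub>m 1 1 $$ (0,0) = (1\<^sub>m 1 :: 'a mat) $$ (0,0)" by (rule arg_cong)
    thus False by simp
  qed
qed

text \<open>
  Induction on the number of columns: if the last column lies in the column space of the left
  factor for the others, then only the right factor is enlarged; otherwise the rank grows by one.
\<close>
lemma rank_factorization:
  "X \<in> carrier_mat n k \<Longrightarrow>
   \<exists>r. \<exists>P \<in> left_invertible n r. \<exists>Q \<in> right_invertible r k. X = P * (Q :: 'a::field mat)"
proof (induction k arbitrary: X)
  case 0
  have "(0\<^sub>m n 0 :: 'a mat) \<in> left_invertible n 0"
    by (rule left_invertibleI[where L = "0\<^sub>m 0 n"]) (auto intro: eq_matI)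
  moreover have "(0\<^sub>m 0 0 :: 'a mat) \<in> right_invertible 0 0"
    by (rule right_invertibleI[where R = "0\<^sub>m 0 0"]) (auto intro: eq_matI)
  moreover have "X = 0\<^sub>m n 0 * 0\<^sub>m 0 0" using 0 by (intro eq_matI) auto
  ultimately show ?case by blast
next
  case (Suc k)
  obtain S T e f :: "'a mat" where "mat_splitting (Suc k) k 1 S T e f"
    using last_coordinate_splitting by blast
  then interpret s: mat_splitting "Suc k" k 1 S T e f .
  note [simp] = carrier_matD[OF Suc.prems]
  obtain r P Q where P: "P \<in> left_invertible n r" and Q: "Q \<in> right_invertible r k"
    and XS: "X * S = P * Q"
    using Suc.IH[of "X * S"] by (auto simp: s.rules)
  have Pc: "P \<in> carrier_mat n r" using P by (auto simp: left_invertible_def)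
  obtain R where Qc: "Q \<in> carrier_mat r k" and R: "R \<in> carrier_mat k r" and QR: "Q * R = 1\<^sub>m r"
    using Q by (rule right_invertibleE)
  note [simp] = carrier_matD[OF Pc] carrier_matD[OF Qc] carrier_matD[OF R]
  have X: "X = P * (Q * T) + X * (e * f)"
  proof -
    have "X * S * T = P * (Q * T)" by (simp add: XS s.rules)
    thus ?thesis using s.cols_decomp[of X] by (simp add: s.rules)
  qed
  show ?case
  proof (cases "\<exists>w \<in> carrier_mat r 1. P * w = X * e")
    case True
    then obtain w where w: "w \<in> carrier_mat r 1" and Pw: "P * w = X * e" by blast
    note [simp] = carrier_matD[OF w]
    have "X * (e * f) = P * (w * f)"
      using arg_cong[OF Pw, of "\<lambda>Z. Z * f"] by (simp add: s.rules)
    hence "X = P * (Q * T + w * f)" using X by (simp add: s.rules)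
    moreover have "(Q * T + w * f) * (S * R) = 1\<^sub>m r" by (simp add: s.rules QR)
    hence "Q * T + w * f \<in> right_invertible r (Suc k)"
      by (intro right_invertibleI[where R = "S * R"]) (simp_all add: s.rules)
    ultimately show ?thesis using P by blast
  next
    case False
    obtain S' T' e' f' :: "'a mat" where s': "mat_splitting (Suc r) r 1 S' T' e' f'"
      using last_coordinate_splitting by blast
    interpret s': mat_splitting "Suc r" r 1 S' T' e' f' by (rule s')
    have "P * T' + (X * e) * f' \<in> left_invertible n (Suc r)"
      using False by (intro left_invertible_append[OF s' P]) (auto simp: s.rules)
    moreover have "(S' * (Q * T) + e' * f) * (S * (R * T') + e * f') = S' * T' + e' * f'"
      by (simp add: s.rules s'.rules mat_head_rewrite[OF QR])
    hence "(S' * (Q * T) + e' * f) * (S * (R * T') + e * f') = 1\<^sub>m (Suc r)"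
      by (simp add: s'.decomposition)
    hence "S' * (Q * T) + e' * f \<in> right_invertible (Suc r) (Suc k)"
      by (intro right_invertibleI[where R = "S * (R * T') + e * f'"]) (simp_all add: s.rules s'.rules)
    moreover have "X = (P * T' + (X * e) * f') * (S' * (Q * T) + e' * f)"
      using X by (simp add: s.rules s'.rules)
    ultimately show ?thesis by blast
  qed
qed

text \<open>
  A matrix with a left inverse splits the target space: the complementary summand comes from a rank
  factorization of the idempotent \<open>1 - P * L\<close>.
\<close>
lemma ex_mat_splitting:
  assumes P: "P \<in> carrier_mat n m" and L: "L \<in> carrier_mat m n" and LP: "L * P = 1\<^sub>m m"
  shows "\<exists>k P' L'. mat_splitting n m k P L P' (L' :: 'a::field mat)"
proof -
  note [simp] = carrier_matD[OF P] carrier_matD[OF L]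
  define E where "E = 1\<^sub>m n - P * L"
  have E: "E \<in> carrier_mat n n" by (simp add: E_def)
  obtain k P' L' where P'l: "P' \<in> left_invertible n k" and L'r: "L' \<in> right_invertible k n" 
    and E_eq: "E = P' * L'"
    using rank_factorization[OF E] by auto
  obtain K where P': "P' \<in> carrier_mat n k" and K: "K \<in> carrier_mat k n" and KP': "K * P' = 1\<^sub>m k"
    using P'l by (rule left_invertibleE)
  obtain R where L': "L' \<in> carrier_mat k n" and R: "R \<in> carrier_mat n k" and L'R: "L' * R = 1\<^sub>m k"
    using L'r by (rule right_invertibleE)
  note [simp] = carrier_matD[OF P'] carrier_matD[OF L'] carrier_matD[OF K] carrier_matD[OF R]
  have L'_eq: "L' = K * E" by (simp add: E_eq mat_head_rewrite[OF KP'])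
  have P'_eq: "P' = E * R" by (simp add: E_eq mat_simps L'R)
  have LE: "L * E = 0\<^sub>m m n" by (simp add: E_def mat_simps mat_head_rewrite[OF LP])
  have EP: "E * P = 0\<^sub>m n m" by (simp add: E_def mat_simps LP)
  have EE: "E * E = E"
    by (simp add: E_def mat_simps mat_head_rewrite[OF LP])
  show ?thesis
  proof (intro exI)
    show "mat_splitting n m k P L P' L'"
    proof
      have "L' * P' = K * ((E * E) * R)" using E by (simp add: L'_eq P'_eq mat_simps)
      also have "\<dots> = K * (E * R)" by (simp only: EE)
      finally show "L' * P' = 1\<^sub>m k" by (simp add: P'_eq[symmetric] KP')
      show "L * P' = 0\<^sub>m m k"
        using E by (simp add: P'_eq mat_head_rewrite[OF LE])
      show "L' * P = 0\<^sub>m k m"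
        using E by (simp add: L'_eq mat_simps EP)
      show "P * L + P' * L' = 1\<^sub>m n"
        unfolding E_eq[symmetric] E_def by (rule eq_matI) auto
    qed (use P L P' L' LP in auto)
  qed
qed

section \<open>Counting matrices by rank\<close>

lemma left_invertible_subset: "left_invertible n m \<subseteq> carrier_mat n m"
  by (auto simp: left_invertible_def)

lemma right_invertible_subset: "right_invertible m n \<subseteq> carrier_mat m n"
  by (auto simp: right_invertible_def)

lemma finite_left_invertible [simp]: "finite (left_invertible n m :: 'a::{field,finite} mat set)"
  by (rule finite_subset[OF left_invertible_subset]) simp

lemma finite_right_invertible [simp]: "finite (right_invertible n m :: 'a::{field,finite} mat set)"
  by (rule finite_subset[OF right_invertible_subset]) simp

lemma left_invertible_imp_le:
  assumes "P \<in> (left_invertible n m :: 'a::{field,finite} mat set)"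
  shows "m \<le> n"
  using assms ex_mat_splitting mat_splitting_dim by (metis left_invertibleE le_add1)

text \<open>
  An injective matrix with \<open>m + 1\<close> columns is an injective matrix with \<open>m\<close> columns together with a
  column outside its column space, which has \<open>q^m\<close> elements.
\<close>
lemma card_left_invertible_Suc:
  "real (card (left_invertible n (Suc m) :: 'a::{field,finite} mat set)) =
   real (card (left_invertible n m :: 'a mat set)) * (real CARD('a) ^ n - real CARD('a) ^ m)"
proof -
  obtain S T e f :: "'a mat" where split: "mat_splitting (Suc m) m 1 S T e f"
    using last_coordinate_splitting by blast
  interpret s: mat_splitting "Suc m" m 1 S T e f by (rule split)
  let ?V = "\<lambda>P :: 'a mat. carrier_mat n 1 - (\<lambda>w. P * w) ` carrier_mat m 1"
  have "bij_betw (\<lambda>M. (M * S, M * e)) (left_invertible n (Suc m)) (Sigma (left_invertible n m) ?V)"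
  proof (rule bij_betwI[where g = "\<lambda>(P, v). P * T + v * f"])
    show "(\<lambda>M. (M * S, M * e)) \<in> left_invertible n (Suc m) \<rightarrow> Sigma (left_invertible n m) ?V"
    proof (intro funcsetI SigmaI DiffI)
      fix M :: "'a mat" assume M: "M \<in> left_invertible n (Suc m)"
      show "M * S \<in> left_invertible n m" by (rule left_invertible_restrict[OF split M])
      have "dim_row M = n" using M left_invertible_subset by auto
      thus "M * e \<in> carrier_mat n 1" by (simp add: s.rules)
      show "M * e \<notin> (\<lambda>w. M * S * w) ` carrier_mat m 1"
        using left_invertible_restrict(2)[OF split M] by fastforce
    qed
    show "(\<lambda>(P, v). P * T + v * f) \<in> Sigma (left_invertible n m) ?V \<rightarrow> left_invertible n (Suc m)"
    proof (intro funcsetI, clarify)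
      fix P v :: "'a mat" 
      assume *: "P \<in> left_invertible n m" "v \<in> carrier_mat n 1" "v \<notin> (\<lambda>w. P * w) ` carrier_mat m 1"
      show "P * T + v * f \<in> left_invertible n (Suc m)"
        by (rule left_invertible_append[OF split *(1,2)]) (use *(3) in \<open>blast\<close>)
    qed
    show "(case (M * S, M * e) of (P, v) \<Rightarrow> P * T + v * f) = M"
      if "M \<in> left_invertible n (Suc m)" for M
    proof -
      have "dim_row M = n" "dim_col M = Suc m" using that left_invertible_subset by auto
      thus ?thesis by (simp add: s.rules s.cols_decomp)
    qed
    show "(\<lambda>M. (M * S, M * e)) (case y of (P, v) \<Rightarrow> P * T + v * f) = y"
      if "y \<in> Sigma (left_invertible n m) ?V" for y
    proof -
      obtain P v where y: "y = (P, v)" by (cases y)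
      have "dim_row P = n" "dim_col P = m" "dim_row v = n" "dim_col v = 1"
        using that y left_invertible_subset by auto
      thus ?thesis by (simp add: s.rules y)
    qed
  qed
  hence "card (left_invertible n (Suc m) :: 'a mat set) = card (Sigma (left_invertible n m) ?V)"
    by (rule bij_betw_same_card)
  also have "\<dots> = (\<Sum>P\<in>left_invertible n m. card (?V P))"
    by (subst card_SigmaI) auto
  finally have card_eq: "real (card (left_invertible n (Suc m) :: 'a mat set)) =
      (\<Sum>P\<in>left_invertible n m. real (card (?V P)))" by simp
  also have "\<dots> = (\<Sum>P\<in>(left_invertible n m :: 'a mat set). real CARD('a) ^ n - real CARD('a) ^ m)"
  proof (rule sum.cong[OF refl])
    fix P :: "'a mat" assume P: "P \<in> left_invertible n m"
    obtain L where c: "P \<in> carrier_mat n m" "L \<in> carrier_mat m n" and LP: "L * P = 1\<^sub>m m"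
      using P by (rule left_invertibleE)
    note d = carrier_matD[OF c(1)] carrier_matD[OF c(2)]
    have inj: "inj_on (\<lambda>w. P * w) (carrier_mat m 1)"
      by (rule inj_on_inverseI[where g = "\<lambda>v. L * v"]) (simp add: mat_head_rewrite[OF LP] d)
    have "(\<lambda>w. P * w) ` carrier_mat m 1 \<subseteq> carrier_mat n 1" by (auto simp: d)
    hence "card (?V P) = CARD('a) ^ n - CARD('a) ^ m"
      by (simp add: card_Diff_subset card_image[OF inj] card_carrier_mat del: mat_carrier_iff One_nat_def)
    moreover have "CARD('a) ^ m \<le> CARD('a) ^ n"
      by (rule power_increasing[OF left_invertible_imp_le[OF P]]) (use two_le_card_field[where ?'a='a] in linarith)
    ultimately show "real (card (?V P)) = real CARD('a) ^ n - real CARD('a) ^ m"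
      by (simp add: of_nat_diff)
  qed
  finally show ?thesis by simp
qed

lemma card_left_invertible:
  "real (card (left_invertible n m :: 'a::{field,finite} mat set)) =
     (\<Prod>i<m. real CARD('a) ^ n - real CARD('a) ^ i)"
proof (induction m)
  case 0
  have zero: "0\<^sub>m 0 n \<in> carrier_mat 0 n \<and> 0\<^sub>m 0 n * X = (1\<^sub>m 0 :: 'a mat)"
    if "X \<in> carrier_mat n 0" for X :: "'a mat"
    using that by (auto intro: eq_matI)
  have "left_invertible n 0 = (carrier_mat n 0 :: 'a mat set)"
    using left_invertible_subset zero by (blast intro: left_invertibleI)
  thus ?case by (simp add: card_carrier_mat)
qed (simp add: card_left_invertible_Suc)

lemma card_right_invertible:
  "card (right_invertible m n :: 'a::field mat set) = card (left_invertible n m :: 'a mat set)"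
proof -
  have "bij_betw transpose_mat (right_invertible m n :: 'a mat set) (left_invertible n m)"
  proof (rule bij_betwI[where g = transpose_mat])
    show "transpose_mat \<in> (right_invertible m n :: 'a mat set) \<rightarrow> left_invertible n m"
    proof
      fix Q :: "'a mat" assume "Q \<in> right_invertible m n"
      then obtain R where c: "Q \<in> carrier_mat m n" "R \<in> carrier_mat n m" and QR: "Q * R = 1\<^sub>m m"
        by (rule right_invertibleE)
      have "transpose_mat R * transpose_mat Q = 1\<^sub>m m"
        using transpose_mult[OF c] QR by simp
      thus "transpose_mat Q \<in> left_invertible n m"
        using c by (intro left_invertibleI[where L = "transpose_mat R"]) auto
    qed
    show "transpose_mat \<in> (left_invertible n m :: 'a mat set) \<rightarrow> right_invertible m n"
    proof
      fix P :: "'a mat" assume "P \<in> left_invertible n m"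
      then obtain L where c: "P \<in> carrier_mat n m" "L \<in> carrier_mat m n" and LP: "L * P = 1\<^sub>m m"
        by (rule left_invertibleE)
      have "transpose_mat P * transpose_mat L = 1\<^sub>m m"
        using transpose_mult[OF c(2,1)] LP by simp
      thus "transpose_mat P \<in> right_invertible m n"
        using c by (intro right_invertibleI[where R = "transpose_mat L"]) auto
    qed
  qed auto
  thus ?thesis by (rule bij_betw_same_card)
qed

lemma left_invertible_square:
  assumes "g \<in> left_invertible n n"
  obtains h where "g \<in> carrier_mat n n" "h \<in> carrier_mat n n" "h * g = 1\<^sub>m n" "g * h = 1\<^sub>m n"
  using assms by (metis left_invertibleE mat_mult_left_right_inverse)

lemma GL_mat_eq: "GL_mat n = left_invertible n n"
proof (intro equalityI subsetI)
  fix A :: "'a mat" assume "A \<in> GL_mat n"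
  then obtain B where A: "A \<in> carrier_mat n n" and inv: "inverts_mat A B" "inverts_mat B A"
    by (auto simp: GL_mat_def invertible_mat_def simp del: mat_carrier_iff)
  have eqs: "A * B = 1\<^sub>m n" "B * A = 1\<^sub>m (dim_row B)"
    using inv A by (auto simp: inverts_mat_def)
  have "dim_col (A * B) = n" "dim_col (B * A) = dim_row B" by (simp_all only: eqs) simp_all
  hence "B \<in> carrier_mat n n" using A by auto
  thus "A \<in> left_invertible n n"
    using A eqs by (intro left_invertibleI[where L = B]) auto
next
  fix A :: "'a mat" assume "A \<in> left_invertible n n"
  then obtain B where "A \<in> carrier_mat n n" "B \<in> carrier_mat n n" "B * A = 1\<^sub>m n" "A * B = 1\<^sub>m n"
    by (rule left_invertible_square)
  thus "A \<in> GL_mat n"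
    by (auto simp: GL_mat_def invertible_mat_def inverts_mat_def intro!: exI[of _ B])
qed

text \<open>
  The square matrices of size \<open>n\<close> and rank \<open>r\<close>, defined as those that factor through \<open>F\<^sup>r\<close> as an
  injection after a surjection.
\<close>
definition rank_mats :: "nat \<Rightarrow> nat \<Rightarrow> 'a::field mat set" where
  "rank_mats n r = (\<lambda>(P, Q). P * Q) ` (left_invertible n r \<times> right_invertible r n)"

lemma rank_matsE:
  assumes "A \<in> rank_mats n r"
  obtains P L Q R where "P \<in> carrier_mat n r" "L \<in> carrier_mat r n" "L * P = 1\<^sub>m r"
    "Q \<in> carrier_mat r n" "R \<in> carrier_mat n r" "Q * R = 1\<^sub>m r" "A = P * Q"
  using assms by (auto simp: rank_mats_def elim!: left_invertibleE right_invertibleE simp del: mat_carrier_iff)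

lemma rank_mats_subset: "rank_mats n r \<subseteq> carrier_mat n n"
  by (auto elim!: rank_matsE)

lemma finite_rank_mats [simp]: "finite (rank_mats n r :: 'a::{field,finite} mat set)"
  by (rule finite_subset[OF rank_mats_subset]) simp

text \<open>
  Two rank factorizations \<open>P * Q = P' * Q'\<close> of the same matrix are compared through \<open>L * P'\<close> and \<open>Q' * R\<close>,
  whose product is the identity.
\<close>
lemma rank_mats_le:
  assumes A: "(A :: 'a::{field,finite} mat) \<in> rank_mats n r" "A \<in> rank_mats n s"
  shows "r \<le> s"
proof -
  obtain P L Q R where c: "P \<in> carrier_mat n r" "L \<in> carrier_mat r n" "Q \<in> carrier_mat r n" 
      "R \<in> carrier_mat n r" and eqs: "L * P = 1\<^sub>m r" "Q * R = 1\<^sub>m r" "A = P * Q"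
    using A(1) by (rule rank_matsE)
  obtain P' L' Q' R' where c': "P' \<in> carrier_mat n s" "L' \<in> carrier_mat s n" "Q' \<in> carrier_mat s n" 
      "R' \<in> carrier_mat n s" and eqs': "L' * P' = 1\<^sub>m s" "Q' * R' = 1\<^sub>m s" "A = P' * Q'"
    using A(2) by (rule rank_matsE)
  note d = carrier_matD[OF c(1)] carrier_matD[OF c(2)] carrier_matD[OF c(3)] carrier_matD[OF c(4)]
    carrier_matD[OF c'(1)] carrier_matD[OF c'(2)] carrier_matD[OF c'(3)] carrier_matD[OF c'(4)]
  have eq: "P' * Q' = P * Q" using eqs eqs' by simp
  have "(L * P') * (Q' * R) = 1\<^sub>m r"
    by (simp add: mat_simps d mat_head_rewrite[OF eq] mat_head_rewrite[OF eqs(1)] eqs)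
  hence "Q' * R \<in> left_invertible s r"
    by (intro left_invertibleI[where L = "L * P'"]) (auto simp: d)
  thus ?thesis by (rule left_invertible_imp_le)
qed

lemma rank_mats_rank_le:
  "(A :: 'a::{field,finite} mat) \<in> rank_mats n r \<Longrightarrow> r \<le> n"
  by (auto simp: rank_mats_def dest: left_invertible_imp_le)

lemma sum_by_rank:
  fixes F :: "'a::{field,finite} mat \<Rightarrow> nat"
  shows "(\<Sum>A\<in>carrier_mat n n. F A) = (\<Sum>r\<le>n. \<Sum>A\<in>rank_mats n r. F A)"
proof -
  have "carrier_mat n n \<subseteq> (\<Union>r\<le>n. rank_mats n r :: 'a mat set)"
  proof
    fix A :: "'a mat" assume "A \<in> carrier_mat n n"
    then obtain r where "A \<in> rank_mats n r"
      unfolding rank_mats_def using rank_factorization[of A n n] by fast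
    thus "A \<in> (\<Union>r\<le>n. rank_mats n r)" using rank_mats_rank_le by auto
  qed
  hence eq: "carrier_mat n n = (\<Union>r\<le>n. rank_mats n r :: 'a mat set)"
    using rank_mats_subset by blast
  have "(\<Sum>A\<in>(\<Union>r\<le>n. rank_mats n r). F A) = (\<Sum>r\<le>n. \<Sum>A\<in>rank_mats n r. F A)"
  proof (rule sum.UNION_disjoint)
    show "\<forall>r\<in>{..n}. \<forall>s\<in>{..n}. r \<noteq> s \<longrightarrow> rank_mats n r \<inter> rank_mats n s = ({} :: 'a mat set)"
      using rank_mats_le by (metis antisym disjoint_iff)
  qed simp_all
  thus ?thesis by (simp only: eq)
qed

text \<open>
  The group \<open>GL\<^sub>r\<close> acts simply transitively on the rank factorizations \<open>P * Q\<close> of a given matrix of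
  rank \<open>r\<close>, by \<open>(P g, g\<inverse> Q)\<close>.
\<close>
lemma sum_rank_factorizations:
  fixes F :: "'a::{field,finite} mat \<Rightarrow> nat"
  shows "(\<Sum>P\<in>left_invertible n r. \<Sum>Q\<in>right_invertible r n. F (P * Q)) =
         card (left_invertible r r :: 'a mat set) * (\<Sum>A\<in>rank_mats n r. F A)"
proof -
  let ?S = "left_invertible n r \<times> right_invertible r n :: ('a mat \<times> 'a mat) set"
  have fiber: "card {x \<in> ?S. (\<lambda>(P, Q). P * Q) x = A} = card (left_invertible r r :: 'a mat set)"
    if A: "A \<in> rank_mats n r" for A
  proof -
    obtain P L Q R where c: "P \<in> carrier_mat n r" "L \<in> carrier_mat r n" "Q \<in> carrier_mat r n" 
      "R \<in> carrier_mat n r" and LP: "L * P = 1\<^sub>m r" and QR: "Q * R = 1\<^sub>m r" and A: "A = P * Q"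
      using A by (rule rank_matsE)
    note d [simp] = carrier_matD[OF c(1)] carrier_matD[OF c(2)] carrier_matD[OF c(3)] carrier_matD[OF c(4)]
    have "bij_betw (\<lambda>g. (P * g, (SOME h. h \<in> carrier_mat r r \<and> h * g = 1\<^sub>m r) * Q)) (left_invertible r r)
            {x \<in> ?S. (\<lambda>(P, Q). P * Q) x = A}" 
      (is "bij_betw ?f _ ?T")
    proof (rule bij_betwI[where g = "\<lambda>(P1, Q1). L * P1"])
      have inv: "\<exists>h. (SOME h. h \<in> carrier_mat r r \<and> h * g = 1\<^sub>m r) = h \<and> h * g = 1\<^sub>m r \<and> g * h = 1\<^sub>m r 
          \<and> h \<in> carrier_mat r r \<and> g \<in> carrier_mat r r"
        if "g \<in> left_invertible r r" for g :: "'a mat"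
      proof -
        define h where "h = (SOME h. h \<in> carrier_mat r r \<and> h * g = 1\<^sub>m r)"
        have "\<exists>h. h \<in> carrier_mat r r \<and> h * g = 1\<^sub>m r"
          using that by (auto simp: left_invertible_def simp del: mat_carrier_iff)
        from someI_ex[OF this] have "h \<in> carrier_mat r r" "h * g = 1\<^sub>m r" by (auto simp: h_def)
        moreover have "g \<in> carrier_mat r r" using that left_invertible_subset by blast
        ultimately show ?thesis 
          unfolding h_def[symmetric] using mat_mult_left_right_inverse[of h r g] by blast
      qed
      show "?f \<in> left_invertible r r \<rightarrow> ?T"
      proof
        fix g :: "'a mat" assume "g \<in> left_invertible r r"
        from inv[OF this] obtain h where h: "(SOME h. h \<in> carrier_mat r r \<and> h * g = 1\<^sub>m r) = h"
          "h * g = 1\<^sub>m r" "g * h = 1\<^sub>m r" "h \<in> carrier_mat r r" "g \<in> carrier_mat r r" by blast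
        note d' [simp] = carrier_matD[OF h(4)] carrier_matD[OF h(5)]
        have "P * g \<in> left_invertible n r"
          by (rule left_invertibleI[where L = "h * L"]) (simp_all add: mat_simps mat_head_rewrite[OF LP] h(2))
        moreover have "h * Q \<in> right_invertible r n"
          by (rule right_invertibleI[where R = "R * g"]) (simp_all add: mat_simps mat_head_rewrite[OF QR] h(2))
        moreover have "(P * g) * (h * Q) = A"
          by (simp add: mat_simps A mat_head_rewrite[OF h(3)])
        ultimately show "?f g \<in> ?T" unfolding h(1) by simp
      qed
      show "(\<lambda>(P1, Q1). L * P1) \<in> ?T \<rightarrow> left_invertible r r"
      proof
        fix x assume "x \<in> ?T"
        then obtain P1 Q1 where x: "x = (P1, Q1)" and
          *: "P1 \<in> left_invertible n r" "Q1 \<in> right_invertible r n" "P1 * Q1 = A" by auto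
        from *(2) obtain R1 where c1: "Q1 \<in> carrier_mat r n" "R1 \<in> carrier_mat n r" "Q1 * R1 = 1\<^sub>m r"
          by (rule right_invertibleE)
        have P1: "P1 \<in> carrier_mat n r" using *(1) left_invertible_subset by blast
        note d' [simp] = carrier_matD[OF c1(1)] carrier_matD[OF c1(2)] carrier_matD[OF P1]
        have eq: "P1 * Q1 = P * Q" using *(3) A by simp
        have "(L * P1) * (Q1 * R) = 1\<^sub>m r"
          by (simp add: mat_simps mat_head_rewrite[OF eq] mat_head_rewrite[OF LP] LP QR)
        from mat_mult_left_right_inverse[OF _ _ this]
        show "(\<lambda>(P1, Q1). L * P1) x \<in> left_invertible r r"
          unfolding x prod.case by (intro left_invertibleI[where L = "Q1 * R"]) simp_all
      qed
      show "(\<lambda>(P1, Q1). L * P1) (?f g) = g" if "g \<in> left_invertible r r" for g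
        using that left_invertible_subset[of r r] by (auto simp: mat_head_rewrite[OF LP])
      show "?f ((\<lambda>(P1, Q1). L * P1) x) = x" if "x \<in> ?T" for x
      proof -
        obtain P1 Q1 where x: "x = (P1, Q1)" by (cases x)
        have *: "P1 \<in> left_invertible n r" "Q1 \<in> right_invertible r n" "P1 * Q1 = A"
          using that x by auto
        from *(2) obtain R1 where c1: "Q1 \<in> carrier_mat r n" "R1 \<in> carrier_mat n r" "Q1 * R1 = 1\<^sub>m r"
          by (rule right_invertibleE)
        have P1: "P1 \<in> carrier_mat n r" using *(1) left_invertible_subset by blast
        note d' [simp] = carrier_matD[OF c1(1)] carrier_matD[OF c1(2)] carrier_matD[OF P1]
        have eq: "P1 * Q1 = P * Q" using *(3) A by simp
        have P1_eq: "P1 = P * (Q * R1)"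
          using arg_cong[OF eq, of "\<lambda>X. X * R1"] by (simp add: mat_simps c1(3))
        have 1: "P * (L * P1) = P1"
          by (subst (1 2) P1_eq) (simp add: mat_simps mat_head_rewrite[OF LP])
        have g: "(L * P1) * (Q1 * R) = 1\<^sub>m r"
          by (simp add: mat_simps mat_head_rewrite[OF eq] mat_head_rewrite[OF LP] LP QR)
        from mat_mult_left_right_inverse[OF _ _ this] have "L * P1 \<in> left_invertible r r"
          by (intro left_invertibleI[where L = "Q1 * R"]) simp_all
        from inv[OF this] obtain h where h: "(SOME h. h \<in> carrier_mat r r \<and> h * (L * P1) = 1\<^sub>m r) = h"
          "h * (L * P1) = 1\<^sub>m r" "h \<in> carrier_mat r r" by blast
        note d'' [simp] = carrier_matD[OF h(3)]
        have "Q = L * (P * Q)" by (simp add: mat_head_rewrite[OF LP])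
        hence "h * Q = h * (L * (P1 * Q1))" by (simp add: eq)
        also have "\<dots> = (h * (L * P1)) * Q1" by (simp add: mat_simps)
        also have "\<dots> = Q1" by (simp add: h(2))
        finally show ?thesis using 1 h(1) by (simp add: x)
      qed
    qed
    thus ?thesis by (simp add: bij_betw_same_card)
  qed
  have "(\<Sum>P\<in>left_invertible n r. \<Sum>Q\<in>right_invertible r n. F (P * Q)) =
        (\<Sum>x\<in>?S. F ((\<lambda>(P, Q). P * Q) x))"
    by (simp add: sum.cartesian_product case_prod_unfold)
  also have "\<dots> = (\<Sum>A\<in>rank_mats n r. of_nat (card {x \<in> ?S. (\<lambda>(P, Q). P * Q) x = A}) * F A)"
    by (rule sum_fun_comp) (auto simp: rank_mats_def)
  also have "\<dots> = card (left_invertible r r :: 'a mat set) * (\<Sum>A\<in>rank_mats n r. F A)"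
    unfolding sum_distrib_left using fiber by (intro sum.cong) auto
  finally show ?thesis .
qed

section \<open>The recursion on the exponent\<close>

lemma mat_add_diff_cancel:
  "dim_row X = n \<Longrightarrow> dim_col X = m \<Longrightarrow> dim_row A = n \<Longrightarrow> dim_col A = m \<Longrightarrow>
   dim_row B = n \<Longrightarrow> dim_col B = m \<Longrightarrow> (X + B) + (A - X) = A + (B :: 'a::field mat)"
  by (auto intro!: eq_matI)

text \<open>
  The surjections \<open>Q\<close> with prescribed composite \<open>Q * P = A\<close>: decompose the source along \<open>P\<close> and the
  target along the image of \<open>A\<close>. On the complement of \<open>P\<close>, the component of \<open>Q\<close> in the image of \<open>A\<close>
  is arbitrary, and the component in the cokernel of \<open>A\<close> has to be surjective.
\<close>
lemma card_right_invertible_extensions: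
  assumes A: "(A :: 'a::{field,finite} mat) \<in> rank_mats m r" and P: "P \<in> left_invertible n m"
  shows "card {Q \<in> right_invertible m n. Q * P = A} =
         CARD('a) ^ (r * (n - m)) * card (right_invertible (m - r) (n - m) :: 'a mat set)"
proof -
  obtain L where c: "P \<in> carrier_mat n m" "L \<in> carrier_mat m n" and LP: "L * P = 1\<^sub>m m"
    using P by (rule left_invertibleE)
  obtain d P' L' where sp: "mat_splitting n m d P L P' L'"
    using ex_mat_splitting[OF c LP] by blast
  have d: "n - m = d" using mat_splitting_dim[OF sp] by simp
  interpret s: mat_splitting n m d P L P' L' by (rule sp)
  obtain P1 K1 Q1 R1 where c1: "P1 \<in> carrier_mat m r" "K1 \<in> carrier_mat r m" "K1 * P1 = 1\<^sub>m r"
    "Q1 \<in> carrier_mat r m" "R1 \<in> carrier_mat m r" and QR: "Q1 * R1 = 1\<^sub>m r" and A: "A = P1 * Q1"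
    using A by (rule rank_matsE)
  obtain g P2 K2 where tp: "mat_splitting m r g P1 K1 P2 K2"
    using ex_mat_splitting[OF c1(1,2,3)] by blast
  have g: "m - r = g" using mat_splitting_dim[OF tp] by simp
  interpret t: mat_splitting m r g P1 K1 P2 K2 by (rule tp)
  note [simp] = carrier_matD[OF c1(4)] carrier_matD[OF c1(5)]
  have "bij_betw (\<lambda>Q. (K1 * (Q * P'), K2 * (Q * P'))) {Q \<in> right_invertible m n. Q * P = A}
          (carrier_mat r d \<times> right_invertible g d)"
  proof (rule bij_betwI[where g = "\<lambda>(Y, Z). A * L + (P1 * Y + P2 * Z) * L'"])
    show "(\<lambda>Q. (K1 * (Q * P'), K2 * (Q * P'))) \<in> {Q \<in> right_invertible m n. Q * P = A}
          \<rightarrow> carrier_mat r d \<times> right_invertible g d"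
    proof
      fix Q assume "Q \<in> {Q \<in> right_invertible m n. Q * P = A}"
      hence QP: "Q * P = A" and "Q \<in> right_invertible m n" by auto
      from this(2) obtain R where cR: "Q \<in> carrier_mat m n" "R \<in> carrier_mat n m" and QR': "Q * R = 1\<^sub>m m"
        by (rule right_invertibleE)
      note [simp] = carrier_matD[OF cR(1)] carrier_matD[OF cR(2)]
      have "K2 * Q = K2 * (Q * (P * L) + Q * (P' * L'))"
        by (simp add: s.cols_decomp)
      also have "\<dots> = K2 * ((Q * P) * L) + K2 * (Q * (P' * L'))" by (simp add: s.rules t.dims)
      also have "\<dots> = K2 * (Q * (P' * L'))" by (simp add: QP A s.rules t.rules)
      finally have K2Q: "K2 * (Q * (P' * L')) = K2 * Q" by simp
      have "(K2 * (Q * P')) * (L' * (R * P2)) = (K2 * (Q * (P' * L'))) * (R * P2)"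
        by (simp add: s.rules t.dims)
      also have "\<dots> = 1\<^sub>m g" 
        unfolding K2Q by (simp add: mat_head_rewrite[OF QR'] t.rules)
      finally have "K2 * (Q * P') \<in> right_invertible g d"
        by (intro right_invertibleI[where R = "L' * (R * P2)"]) (simp_all add: s.dims t.dims)
      thus "(K1 * (Q * P'), K2 * (Q * P')) \<in> carrier_mat r d \<times> right_invertible g d"
        by (simp add: s.dims t.dims)
    qed
    show "(\<lambda>(Y, Z). A * L + (P1 * Y + P2 * Z) * L') \<in> carrier_mat r d \<times> right_invertible g d \<rightarrow>
           {Q \<in> right_invertible m n. Q * P = A}"
    proof
      fix x :: "'a mat \<times> 'a mat" assume x_in: "x \<in> carrier_mat r d \<times> right_invertible g d"
      obtain Y Z where x: "x = (Y, Z)" by (cases x)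
      have Y: "Y \<in> carrier_mat r d" and "Z \<in> right_invertible g d" using x_in x by auto
      from this(2) obtain D where cD: "Z \<in> carrier_mat g d" "D \<in> carrier_mat d g" and ZD: "Z * D = 1\<^sub>m g"
        by (rule right_invertibleE)
      note [simp] = carrier_matD[OF cD(1)] carrier_matD[OF cD(2)] carrier_matD[OF Y]
      let ?Q = "A * L + (P1 * Y + P2 * Z) * L'"
      \<comment> \<open>first hit the component in the cokernel of \<open>A\<close>, then correct the component in its image\<close>
      let ?W = "P' * (D * K2) + P * (R1 * (K1 - Y * (D * K2)))"
      have "?Q * ?W = (P1 * (Y * (D * K2)) + P2 * K2) + (P1 * K1 - P1 * (Y * (D * K2)))"
        by (simp add: A s.rules t.dims mat_head_rewrite[OF ZD] mat_head_rewrite[OF QR])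
      also have "\<dots> = P1 * K1 + P2 * K2"
        by (rule mat_add_diff_cancel[of _ m m]) (simp_all add: t.dims)
      finally have "?Q * ?W = 1\<^sub>m m" by (simp add: t.decomposition)
      hence "?Q \<in> right_invertible m n"
        by (intro right_invertibleI[where R = ?W]) (simp_all add: A s.dims t.dims)
      moreover have "?Q * P = A"
        by (simp add: A s.rules t.dims)
      ultimately show "(case x of (Y, Z) \<Rightarrow> A * L + (P1 * Y + P2 * Z) * L') \<in>
          {Q \<in> right_invertible m n. Q * P = A}" by (simp add: x)
    qed
    show "(case (K1 * (Q * P'), K2 * (Q * P')) of (Y, Z) \<Rightarrow> A * L + (P1 * Y + P2 * Z) * L') = Q"
      if "Q \<in> {Q \<in> right_invertible m n. Q * P = A}" for Q
    proof -
      have QP: "A = Q * P" and "Q \<in> carrier_mat m n" using that right_invertible_subset by auto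
      hence [simp]: "dim_row Q = m" "dim_col Q = n" by auto
      have "P1 * (K1 * (Q * P')) + P2 * (K2 * (Q * P')) = Q * P'" 
        by (rule t.rows_decomp) simp
      thus ?thesis using s.cols_decomp[of Q] by (simp add: QP s.rules)
    qed
    show "(\<lambda>Q. (K1 * (Q * P'), K2 * (Q * P'))) (case x of (Y, Z) \<Rightarrow> A * L + (P1 * Y + P2 * Z) * L') = x"
      if "x \<in> carrier_mat r d \<times> right_invertible g d" for x
    proof -
      obtain Y Z where x: "x = (Y, Z)" by (cases x)
      have [simp]: "dim_row Y = r" "dim_col Y = d" "dim_row Z = g" "dim_col Z = d"
        using that x right_invertible_subset by auto
      have "(A * L + (P1 * Y + P2 * Z) * L') * P' = P1 * Y + P2 * Z"
        by (simp add: A s.rules t.dims)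
      thus ?thesis by (simp add: x t.rules)
    qed
  qed
  from bij_betw_same_card[OF this] show ?thesis
    by (simp add: card_cartesian_product card_carrier_mat d g del: mat_carrier_iff)
qed

text \<open>
  The second components \<open>B\<close> of the counted pairs with first component \<open>A\<close>.
\<close>
definition annihilated_commutants :: "nat \<Rightarrow> nat \<Rightarrow> 'a::field mat \<Rightarrow> 'a mat set" where
  "annihilated_commutants b n A = {B \<in> carrier_mat n n. A * B = B * A \<and> (A ^\<^sub>m b) * B = 0\<^sub>m n n}"

lemma pow_mat_conjugate:
  assumes "P \<in> carrier_mat n m" "Q \<in> carrier_mat m n"
  shows "((P * Q) ^\<^sub>m b) * P = P * ((Q * (P :: 'a::field mat)) ^\<^sub>m b)"
proof (induction b)
  case 0
  show ?case using assms by simp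
next
  case (Suc b)
  note d = carrier_matD[OF assms(1)] carrier_matD[OF assms(2)]
  have "((P * Q) ^\<^sub>m Suc b) * P = (((P * Q) ^\<^sub>m b) * P) * (Q * P)"
    by (simp add: mat_simps d)
  also have "\<dots> = P * ((Q * P) ^\<^sub>m Suc b)"
    unfolding Suc.IH by (simp add: mat_simps d)
  finally show ?case .
qed

text \<open>
  A matrix \<open>B\<close> that commutes with \<open>P * Q\<close> preserves the image of \<open>P\<close>, on which it acts by
  \<open>L * B * P\<close>, and this restriction satisfies the same conditions for \<open>Q * P\<close> with the exponent lowered
  by one. The restriction determines \<open>B\<close> up to a map from the cokernel of \<open>P\<close> to the kernel of \<open>Q\<close>,
  and both of these spaces have dimension \<open>n - m\<close>.
\<close>
lemma card_annihilated_commutants_Suc: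
  assumes P: "P \<in> left_invertible n m" and Q: "Q \<in> right_invertible m n"
  shows "card (annihilated_commutants (Suc b) n (P * Q)) =
    CARD('a) ^ ((n - m)\<^sup>2) * card (annihilated_commutants b m (Q * (P :: 'a::{field,finite} mat)))"
proof -
  obtain L where c: "P \<in> carrier_mat n m" "L \<in> carrier_mat m n" and LP: "L * P = 1\<^sub>m m"
    using P by (rule left_invertibleE)
  obtain d P' L' where sp: "mat_splitting n m d P L P' L'"
    using ex_mat_splitting[OF c LP] by blast
  have d: "n - m = d" using mat_splitting_dim[OF sp] by simp
  interpret s: mat_splitting n m d P L P' L' by (rule sp)
  obtain R where cR: "Q \<in> carrier_mat m n" "R \<in> carrier_mat n m" and QR: "Q * R = 1\<^sub>m m"
    using Q by (rule right_invertibleE)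
  obtain d' R' Q' where tp: "mat_splitting n m d' R Q R' Q'"
    using ex_mat_splitting[OF cR(2,1) QR] by blast
  have d': "d' = d" using mat_splitting_dim[OF tp] mat_splitting_dim[OF sp] by simp
  interpret t: mat_splitting n m d R Q R' Q' using tp unfolding d' .
  let ?S = "annihilated_commutants (Suc b) n (P * Q)" and ?T = "annihilated_commutants b m (Q * P)"
  \<comment> \<open>the matrix \<open>B\<close> with restriction \<open>B'\<close> to the image of \<open>P\<close> and with \<open>Q' * B * P' = C\<close>\<close>
  let ?inv = "\<lambda>(B', C). R * (B' * Q) + (R' * (Q' * (P * (B' * L))) + R' * (C * L'))"
  note conj = pow_mat_conjugate[OF c(1) cR(1)]
  have S_D: "B * P = P * (L * (B * P))" "Q * B = L * (B * (P * Q))" "B \<in> carrier_mat n n"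
      "B * (P * Q) = P * (Q * B)" "((P * Q) ^\<^sub>m b) * (P * (Q * B)) = 0\<^sub>m n n"
    if "B \<in> ?S" for B
  proof -
    show B: "B \<in> carrier_mat n n" using that by (auto simp: annihilated_commutants_def)
    note [simp] = carrier_matD[OF B]
    show comm: "B * (P * Q) = P * (Q * B)" 
      using that by (simp add: annihilated_commutants_def s.dims t.dims mat_simps)
    have "B * P = (B * (P * Q)) * R" by (simp add: s.dims t.dims mat_simps QR)
    also have "\<dots> = P * (Q * (B * R))" unfolding comm by (simp add: s.dims t.dims mat_simps)
    finally have BP: "B * P = P * (Q * (B * R))" .
    thus "B * P = P * (L * (B * P))" by (simp add: s.rules t.dims)
    show "Q * B = L * (B * (P * Q))" unfolding comm by (simp add: s.rules t.dims)
    show "((P * Q) ^\<^sub>m b) * (P * (Q * B)) = 0\<^sub>m n n"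
      using that by (simp add: comm annihilated_commutants_def s.dims t.dims mat_simps)
  qed
  have T_D: "B' \<in> carrier_mat m m" "Q * (P * B') = B' * (Q * P)" "((Q * P) ^\<^sub>m b) * B' = 0\<^sub>m m m"
    if "B' \<in> ?T" for B'
    using that by (auto simp: annihilated_commutants_def s.dims t.dims mat_simps)
  have inv_P: "?inv (B', C) * P = P * B'" and Q_inv: "Q * ?inv (B', C) = B' * Q"
    if "B' \<in> ?T" "C \<in> carrier_mat d d" for B' C
  proof -
    note T = T_D[OF that(1)]
    note [simp] = carrier_matD[OF T(1)] carrier_matD[OF that(2)]
    have "?inv (B', C) * P = R * (B' * (Q * P)) + R' * (Q' * (P * B'))" 
      by (simp add: s.rules t.dims)
    also have "\<dots> = P * B'"
      unfolding T(2)[symmetric] by (rule t.rows_decomp) (simp add: s.dims)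
    finally show "?inv (B', C) * P = P * B'" .
    show "Q * ?inv (B', C) = B' * Q" by (simp add: s.dims t.rules)
  qed
  have "bij_betw (\<lambda>B. (L * (B * P), Q' * (B * P'))) ?S (?T \<times> carrier_mat d d)"
  proof (rule bij_betwI[where g = ?inv])
    show "(\<lambda>B. (L * (B * P), Q' * (B * P'))) \<in> ?S \<rightarrow> ?T \<times> carrier_mat d d"
    proof
      fix B assume "B \<in> ?S"
      note B = S_D[OF this]
      note [simp] = carrier_matD[OF B(3)]
      have "Q * (P * (L * (B * P))) = (Q * B) * P" unfolding B(1)[symmetric] by (simp add: s.dims t.dims mat_simps)
      also have "\<dots> = (L * (B * P)) * (Q * P)" unfolding B(2) by (simp add: s.dims t.dims mat_simps)
      finally have comm: "Q * (P * (L * (B * P))) = (L * (B * P)) * (Q * P)" .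
      have "((Q * P) ^\<^sub>m b) * (L * (B * P)) = (L * (P * ((Q * P) ^\<^sub>m b))) * ((L * (B * P)) * (Q * R))"
        by (simp add: s.rules t.dims QR)
      also have "\<dots> = (L * (((P * Q) ^\<^sub>m b) * P)) * ((L * (B * P)) * (Q * R))"
        unfolding conj ..
      also have "\<dots> = L * (((P * Q) ^\<^sub>m b) * (P * (L * (B * (P * Q))))) * R"
        by (simp add: s.dims t.dims mat_simps)
      also have "\<dots> = 0\<^sub>m m m"
        unfolding B(2)[symmetric] B(5) by (simp add: s.dims t.dims mat_simps)
      finally have "((Q * P) ^\<^sub>m b) * (L * (B * P)) = 0\<^sub>m m m" .
      with comm have "L * (B * P) \<in> ?T"
        by (simp add: annihilated_commutants_def s.dims t.dims mat_simps)
      thus "(L * (B * P), Q' * (B * P')) \<in> ?T \<times> carrier_mat d d"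
        by (simp add: s.dims t.dims)
    qed
    show "?inv \<in> ?T \<times> carrier_mat d d \<rightarrow> ?S"
    proof
      fix x :: "'a mat \<times> 'a mat" assume x_in: "x \<in> ?T \<times> carrier_mat d d"
      obtain B' C where x: "x = (B', C)" by (cases x)
      have BC: "B' \<in> ?T" "C \<in> carrier_mat d d" using x_in x by auto
      note T = T_D[OF BC(1)]
      note [simp] = carrier_matD[OF T(1)] carrier_matD[OF BC(2)]
      define B where "B = ?inv x"
      have B: "B * P = P * B'" "Q * B = B' * Q"
        using inv_P[OF BC] Q_inv[OF BC] by (simp_all only: B_def x)
      have Bc: "B \<in> carrier_mat n n" by (simp add: B_def x s.dims t.dims)
      note [simp] = carrier_matD[OF Bc]
      have "(P * Q) * B = B * (P * Q)"
      proof -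
        have "(P * Q) * B = P * (B' * Q)" by (simp add: s.dims t.dims mat_simps B(2))
        also have "\<dots> = (B * P) * Q" unfolding B(1) by (simp add: s.dims t.dims mat_simps)
        finally show ?thesis by (simp add: s.dims t.dims mat_simps)
      qed
      moreover have "((P * Q) ^\<^sub>m Suc b) * B = 0\<^sub>m n n"
      proof -
        have "((P * Q) ^\<^sub>m Suc b) * B = (((P * Q) ^\<^sub>m b) * P) * (B' * Q)"
          by (simp add: s.dims t.dims mat_simps B(2))
        also have "\<dots> = P * ((((Q * P) ^\<^sub>m b) * B') * Q)"
          unfolding conj by (simp add: s.dims t.dims mat_simps)
        also have "\<dots> = 0\<^sub>m n n" unfolding T(3) by (simp add: s.dims t.dims mat_simps)
        finally show ?thesis .
      qed
      ultimately show "?inv x \<in> ?S"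
        using Bc by (simp add: annihilated_commutants_def B_def)
    qed
    show "?inv (L * (B * P), Q' * (B * P')) = B" if "B \<in> ?S" for B
    proof -
      note B = S_D[OF that]
      note [simp] = carrier_matD[OF B(3)]
      have 1: "R * ((L * (B * P)) * Q) = R * (Q * B)"
        unfolding B(2) by (simp add: s.dims t.dims mat_simps)
      have "P * ((L * (B * P)) * L) = (P * (L * (B * P))) * L" by (simp add: s.dims t.dims mat_simps)
      also have "\<dots> = B * (P * L)" unfolding B(1)[symmetric] by (simp add: s.dims t.dims mat_simps)
      finally have "R' * (Q' * (P * ((L * (B * P)) * L))) + R' * ((Q' * (B * P')) * L') =
          R' * (Q' * (B * (P * L) + B * (P' * L')))"
        by (simp add: s.dims t.dims mat_simps)
      also have "\<dots> = R' * (Q' * B)" by (simp add: s.cols_decomp)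
      finally show ?thesis
        unfolding prod.case 1 by (simp only:) (simp add: t.rows_decomp)
    qed
    show "(\<lambda>B. (L * (B * P), Q' * (B * P'))) (?inv x) = x" if "x \<in> ?T \<times> carrier_mat d d" for x :: "'a mat \<times> 'a mat"
    proof -
      obtain B' C where x: "x = (B', C)" by (cases x)
      have BC: "B' \<in> ?T" "C \<in> carrier_mat d d" using that x by auto
      note T = T_D[OF BC(1)]
      note [simp] = carrier_matD[OF T(1)] carrier_matD[OF BC(2)]
      have "L * (?inv (B', C) * P) = B'" unfolding inv_P[OF BC] by (simp add: s.rules)
      moreover have "Q' * (?inv (B', C) * P') = C" by (simp add: s.rules t.rules)
      ultimately show ?thesis by (simp add: x)
    qed
  qed
  from bij_betw_same_card[OF this] show ?thesis
    by (simp add: card_cartesian_product card_carrier_mat d power2_eq_square del: mat_carrier_iff)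
qed

text \<open>
  The number of counted pairs whose first component has rank \<open>m\<close>.
\<close>
definition rank_count :: "'a::{field,finite} itself \<Rightarrow> nat \<Rightarrow> nat \<Rightarrow> nat \<Rightarrow> nat" where
  "rank_count _ b n m = (\<Sum>A\<in>(rank_mats n m :: 'a mat set). card (annihilated_commutants b n A))"

lemma finite_annihilated_commutants [simp]:
  "finite (annihilated_commutants b n (A :: 'a::{field,finite} mat))"
  by (rule finite_subset[of _ "carrier_mat n n"]) (auto simp: annihilated_commutants_def)

lemma card_commuting_nil_pairs:
  "card (commuting_nil_pairs b n :: ('a::{field,finite} mat \<times> 'a mat) set) =
   (\<Sum>m\<le>n. rank_count TYPE('a) b n m)"
proof -
  have "(commuting_nil_pairs b n :: ('a mat \<times> 'a mat) set) =
        Sigma (carrier_mat n n) (annihilated_commutants b n)"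
    by (auto simp: commuting_nil_pairs_def annihilated_commutants_def simp del: mat_carrier_iff)
  thus ?thesis
    by (simp add: rank_count_def flip: sum_by_rank)
qed

lemma rank_count_0:
  "card (left_invertible m m :: 'a::{field,finite} mat set) * rank_count TYPE('a) 0 n m =
   card (left_invertible n m :: 'a mat set) * card (left_invertible n m :: 'a mat set)"
proof -
  have one: "card (annihilated_commutants 0 n A) = 1" if "A \<in> carrier_mat n n" for A :: "'a mat"
  proof -
    have "annihilated_commutants 0 n A = {0\<^sub>m n n}"
      using that by (auto simp: annihilated_commutants_def mat_simps)
    thus ?thesis by simp
  qed
  have "card (left_invertible m m :: 'a mat set) * rank_count TYPE('a) 0 n m =
        (\<Sum>P\<in>left_invertible n m. \<Sum>Q\<in>right_invertible m n.
           card (annihilated_commutants 0 n (P * Q :: 'a mat)))"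
    by (simp add: rank_count_def flip: sum_rank_factorizations)
  also have "\<dots> = (\<Sum>P\<in>(left_invertible n m :: 'a mat set). \<Sum>Q\<in>(right_invertible m n :: 'a mat set). 1)"
  proof (intro sum.cong refl one)
    fix P Q :: "'a mat" assume "P \<in> left_invertible n m" "Q \<in> right_invertible m n"
    thus "P * Q \<in> carrier_mat n n" using left_invertible_subset right_invertible_subset by fastforce
  qed
  finally show ?thesis by (simp add: card_right_invertible)
qed

text \<open>
  Every pair \<open>(P, Q)\<close> contributes the count for \<open>Q * P\<close>, a matrix of size \<open>m\<close>; for fixed \<open>P\<close> the sum
  over \<open>Q\<close> is grouped by the matrix \<open>Q * P\<close> and then by its rank \<open>r\<close>.
\<close>
lemma rank_count_Suc:
  "card (left_invertible m m :: 'a::{field,finite} mat set) * rank_count TYPE('a) (Suc b) n m =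
   card (left_invertible n m :: 'a mat set) * (CARD('a) ^ ((n - m)\<^sup>2) *
     (\<Sum>r\<le>m. CARD('a) ^ (r * (n - m)) * card (left_invertible (n - m) (m - r) :: 'a mat set) *
        rank_count TYPE('a) b m r))"
proof -
  let ?f = "\<lambda>A :: 'a mat. card (annihilated_commutants b m A)"
  have fixed_P: "(\<Sum>Q\<in>right_invertible m n. ?f (Q * P)) =
      (\<Sum>r\<le>m. CARD('a) ^ (r * (n - m)) * card (left_invertible (n - m) (m - r) :: 'a mat set) *
        rank_count TYPE('a) b m r)"
    if P: "P \<in> left_invertible n m" for P
  proof -
    have "(\<Sum>Q\<in>right_invertible m n. ?f (Q * P)) =
          (\<Sum>A\<in>carrier_mat m m. of_nat (card {Q \<in> right_invertible m n. Q * P = A}) * ?f A)"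
    proof (rule sum_fun_comp)
      show "(\<lambda>Q. Q * P) ` right_invertible m n \<subseteq> carrier_mat m m"
        using P left_invertible_subset right_invertible_subset by fastforce
    qed simp_all
    also have "\<dots> = (\<Sum>r\<le>m. \<Sum>A\<in>rank_mats m r. card {Q \<in> right_invertible m n. Q * P = A} * ?f A)"
      by (simp add: sum_by_rank)
    also have "\<dots> = (\<Sum>r\<le>m. \<Sum>A\<in>(rank_mats m r :: 'a mat set).
        CARD('a) ^ (r * (n - m)) * card (left_invertible (n - m) (m - r) :: 'a mat set) * ?f A)"
      by (intro sum.cong refl)
        (simp add: card_right_invertible_extensions[OF _ P] card_right_invertible)
    finally show ?thesis by (simp add: rank_count_def sum_distrib_left)
  qed
  have "card (left_invertible m m :: 'a mat set) * rank_count TYPE('a) (Suc b) n m =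
        (\<Sum>P\<in>left_invertible n m. \<Sum>Q\<in>right_invertible m n.
           card (annihilated_commutants (Suc b) n (P * Q :: 'a mat)))"
    by (simp add: rank_count_def flip: sum_rank_factorizations)
  also have "\<dots> = (\<Sum>P\<in>(left_invertible n m :: 'a mat set).
      CARD('a) ^ ((n - m)\<^sup>2) * (\<Sum>Q\<in>right_invertible m n. ?f (Q * P)))"
    by (simp add: card_annihilated_commutants_Suc sum_distrib_left)
  also have "\<dots> = (\<Sum>P\<in>(left_invertible n m :: 'a mat set). CARD('a) ^ ((n - m)\<^sup>2) *
     (\<Sum>r\<le>m. CARD('a) ^ (r * (n - m)) * card (left_invertible (n - m) (m - r) :: 'a mat set) *
        rank_count TYPE('a) b m r))"
    by (intro sum.cong refl arg_cong2[where f = "(*)"] fixed_P)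
  finally show ?thesis by simp
qed

section \<open>q-series\<close>

lemma qpoch_Suc: "qpoch a p (Suc n) = qpoch a p n * (1 - a * p ^ n)"
  by (simp add: qpoch_def)

lemma qpoch_0 [simp]: "qpoch a p 0 = 1"
  by (simp add: qpoch_def)

lemma qpoch_pos:
  fixes p :: real
  assumes "0 \<le> p" "p < 1"
  shows "qpoch p p n > 0"
proof -
  have "p * p ^ i < 1" for i
    using power_Suc_less_one[of p i] assms by (cases "p = 0") auto
  thus ?thesis unfolding qpoch_def by (intro prod_pos) auto
qed

lemma qpoch_inf_nth_LIMSEQ:
  assumes "\<bar>p\<bar> < 1" "fps_nth a 0 = 0"
  shows "(\<lambda>N. fps_nth (qpoch a (fps_const p) N) m) \<longlonglongrightarrow> fps_nth (qpoch_inf a p) m"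
  using qpoch_inf_coeff_convergent[OF assms, of m]
  by (simp add: qpoch_inf_def convergent_LIMSEQ_iff)

lemma mult_qpoch_inf_nth_LIMSEQ:
  assumes "\<bar>p\<bar> < 1" "fps_nth a 0 = 0"
  shows "(\<lambda>N. fps_nth (f * qpoch a (fps_const p) N) m) \<longlonglongrightarrow> fps_nth (f * qpoch_inf a p) m"
  unfolding fps_mult_nth by (intro tendsto_intros qpoch_inf_nth_LIMSEQ assms)

lemma qpoch_inf_split:
  fixes p :: real
  assumes p: "\<bar>p\<bar> < 1" and a: "fps_nth a 0 = 0"
  shows "qpoch_inf a p = qpoch a (fps_const p) k * qpoch_inf (fps_const (p ^ k) * a) p"
proof (rule fps_ext)
  fix m
  have split: "qpoch a (fps_const p) (N + k) =
      qpoch a (fps_const p) k * qpoch (fps_const (p ^ k) * a) (fps_const p) N" for N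
  proof (induction N)
    case (Suc N)
    have "qpoch a (fps_const p) (Suc N + k) =
          qpoch a (fps_const p) (N + k) * (1 - a * fps_const p ^ (N + k))"
      by (simp add: qpoch_Suc)
    thus ?case by (simp add: Suc.IH qpoch_Suc power_add fps_const_power mult_ac
        flip: fps_const_mult)
  qed simp
  have "(\<lambda>N. fps_nth (qpoch a (fps_const p) (N + k)) m) \<longlonglongrightarrow> fps_nth (qpoch_inf a p) m"
    by (intro LIMSEQ_ignore_initial_segment qpoch_inf_nth_LIMSEQ p a)
  moreover have "(\<lambda>N. fps_nth (qpoch a (fps_const p) (N + k)) m) \<longlonglongrightarrow>
      fps_nth (qpoch a (fps_const p) k * qpoch_inf (fps_const (p ^ k) * a) p) m"
    unfolding split by (intro mult_qpoch_inf_nth_LIMSEQ p) (simp add: a)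
  ultimately show "fps_nth (qpoch_inf a p) m =
      fps_nth (qpoch a (fps_const p) k * qpoch_inf (fps_const (p ^ k) * a) p) m"
    by (rule LIMSEQ_unique)
qed

text \<open>
  For \<open>k \<ge> 1\<close>, the series \<open>\<Sum>j. X^(k * j) / (p; p)_j\<close>. By Euler's identity it is the inverse of
  \<open>(X^k; p)_\<infinity>\<close> if \<open>0 < p < 1\<close>.
\<close>
definition euler_series :: "real \<Rightarrow> nat \<Rightarrow> real fps" where
  "euler_series p k = Abs_fps (\<lambda>m. if k dvd m then 1 / qpoch p p (m div k) else 0)"

lemma euler_series_mult_qpoch_inf:
  assumes p: "0 < p" "p < 1" and k: "k \<ge> 1"
  shows "euler_series p k * qpoch_inf (fps_X ^ k) p = 1"
proof (rule fps_ext)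
  fix m
  \<comment> \<open>\<open>E N\<close> is the series with \<open>X^k\<close> replaced by \<open>p^N * X^k\<close>; its coefficients tend to those of 1\<close>
  define E where "E N = Abs_fps (\<lambda>m. if k dvd m then p ^ (N * (m div k)) / qpoch p p (m div k) else 0)" for N
  have E_nth: "fps_nth (E N) m = (if k dvd m then p ^ (N * (m div k)) / qpoch p p (m div k) else 0)" for N m
    by (simp add: E_def)
  have E0: "E 0 = euler_series p k" by (simp add: E_def euler_series_def cong: if_cong)
  have E_Suc: "E N * (1 - fps_X ^ k * fps_const p ^ N) = E (Suc N)" for N
  proof (rule fps_ext)
    fix m
    have "E N * (1 - fps_X ^ k * fps_const p ^ N) = E N - fps_const (p ^ N) * (fps_X ^ k * E N)"
      by (simp add: algebra_simps fps_const_power)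
    hence *: "fps_nth (E N * (1 - fps_X ^ k * fps_const p ^ N)) m =
        fps_nth (E N) m - p ^ N * (if m < k then 0 else fps_nth (E N) (m - k))"
      by (simp add: fps_X_power_mult_nth)
    show "fps_nth (E N * (1 - fps_X ^ k * fps_const p ^ N)) m = fps_nth (E (Suc N)) m"
    proof (cases "k dvd m")
      case False
      hence "\<not> m < k \<Longrightarrow> \<not> k dvd m - k" by (metis dvd_minus_self)
      thus ?thesis using False unfolding * by (simp add: E_nth)
    next
      case True
      then obtain j where m: "m = k * j" by blast
      show ?thesis
      proof (cases j)
        case 0
        thus ?thesis unfolding * using k by (simp add: E_nth m)
      next
        case (Suc i)
        have m': "\<not> m < k" "m - k = k * i" using Suc m by auto
        have c: "qpoch p p i \<noteq> 0" "1 - p * p ^ i \<noteq> 0"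
          using qpoch_pos[of p i] qpoch_pos[of p "Suc i"] p by (auto simp: qpoch_Suc)
        have "p ^ (N * Suc i) / qpoch p p (Suc i) - p ^ N * (p ^ (N * i) / qpoch p p i) =
              p ^ (Suc N * Suc i) / qpoch p p (Suc i)"
          using c by (simp add: qpoch_Suc power_add) (simp add: field_simps)
        thus ?thesis unfolding * using k m' by (simp add: E_nth m Suc)
      qed
    qed
  qed
  have prod: "E 0 * qpoch (fps_X ^ k) (fps_const p) N = E N" for N
    by (induction N) (simp, simp only: qpoch_Suc E_Suc mult.assoc[symmetric])
  have "(\<lambda>N. fps_nth (E 0 * qpoch (fps_X ^ k) (fps_const p) N) m) \<longlonglongrightarrow>
        fps_nth (E 0 * qpoch_inf (fps_X ^ k) p) m"
    using p k by (intro mult_qpoch_inf_nth_LIMSEQ) auto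
  moreover have "(\<lambda>N. fps_nth (E 0 * qpoch (fps_X ^ k) (fps_const p) N) m) \<longlonglongrightarrow> fps_nth 1 m"
  proof (cases "k dvd m \<and> m \<noteq> 0")
    case True
    then obtain j where m: "m = k * j" "j \<noteq> 0" by auto
    have "p ^ j < 1" using p m by (simp add: power_less_one_iff)
    hence "(\<lambda>N. (p ^ j) ^ N / qpoch p p j) \<longlonglongrightarrow> 0 / qpoch p p j"
      using p qpoch_pos[of p j] by (intro tendsto_intros LIMSEQ_power_zero) auto
    moreover have "fps_nth 1 m = (0 :: real)" using True by simp
    ultimately show ?thesis 
      unfolding prod using k by (simp add: E_nth m power_mult[symmetric] mult.commute)
  qed (use k in \<open>auto simp: prod E_nth fps_one_nth\<close>)
  ultimately show "fps_nth (euler_series p k * qpoch_inf (fps_X ^ k) p) m = fps_nth 1 m"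
    unfolding E0 by (rule LIMSEQ_unique)
qed

text \<open>
  The series with the Gaussian binomial coefficient of \<open>m + d\<close> over \<open>d\<close> (in base \<open>p\<close>) as coefficient
  of \<open>X^m\<close>. By the \<open>q\<close>-binomial theorem it is the inverse of \<open>(X; p)_(d + 1)\<close> if \<open>0 < p < 1\<close>.
\<close>
definition gauss_series :: "real \<Rightarrow> nat \<Rightarrow> real fps" where
  "gauss_series p d = Abs_fps (\<lambda>m. qpoch p p (m + d) / (qpoch p p d * qpoch p p m))"

lemma gauss_series_mult_qpoch:
  assumes p: "0 < p" "p < 1"
  shows "gauss_series p d * qpoch fps_X (fps_const p) (Suc d) = 1"
proof -
  have nz: "qpoch p p n \<noteq> 0" "1 - p * p ^ n \<noteq> 0" for n
    using qpoch_pos[of p n] qpoch_pos[of p "Suc n"] p by (auto simp: qpoch_Suc)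
  have step: "fps_nth (gauss_series p d * (1 - fps_X * fps_const p ^ d)) m =
     fps_nth (gauss_series p d) m - p ^ d * (if m = 0 then 0 else fps_nth (gauss_series p d) (m - 1))" for d m
  proof -
    have "gauss_series p d * (1 - fps_X * fps_const p ^ d) =
          gauss_series p d - fps_const (p ^ d) * (fps_X * gauss_series p d)"
      by (simp add: algebra_simps fps_const_power)
    thus ?thesis by simp
  qed
  show ?thesis
  proof (induction d)
    case 0
    have "gauss_series p 0 * (1 - fps_X * fps_const p ^ 0) = 1"
    proof (rule fps_ext)
      fix m show "fps_nth (gauss_series p 0 * (1 - fps_X * fps_const p ^ 0)) m = fps_nth 1 m"
        unfolding step by (simp add: gauss_series_def nz)
    qed
    thus ?case by (simp add: qpoch_Suc)
  next
    case (Suc d)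
    have "gauss_series p (Suc d) * (1 - fps_X * fps_const p ^ Suc d) = gauss_series p d"
    proof (rule fps_ext)
      fix m
      show "fps_nth (gauss_series p (Suc d) * (1 - fps_X * fps_const p ^ Suc d)) m =
            fps_nth (gauss_series p d) m"
      proof (cases m)
        case 0
        thus ?thesis unfolding step by (simp add: gauss_series_def nz)
      next
        case (Suc i)
        define T D A where "T = qpoch p p (i + d) * (1 - p * p ^ (i + d))" 
          and "D = qpoch p p d" and "A = qpoch p p i"
        define u v w where "u = 1 - p * p ^ i" and "v = 1 - p * p ^ d"
          and "w = 1 - p * p ^ (i + Suc d)"
        have nz': "D \<noteq> 0" "A \<noteq> 0" "u \<noteq> 0" "v \<noteq> 0"
          using nz by (simp_all add: D_def A_def u_def v_def)
        have key: "w - p ^ Suc d * u = v"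
          by (simp add: u_def v_def w_def power_add algebra_simps)
        have "T * w / ((D * v) * (A * u)) - p ^ Suc d * (T / ((D * v) * A)) =
              T * (w - p ^ Suc d * u) / ((D * v) * (A * u))"
          using nz' by (simp add: field_simps del: power_Suc)
        also have "\<dots> = T / (D * (A * u))"
          unfolding key using nz' by simp
        finally show ?thesis
          unfolding step
          by (simp add: gauss_series_def Suc qpoch_Suc T_def D_def A_def u_def v_def w_def mult_ac)
      qed
    qed
    moreover have "gauss_series p (Suc d) * qpoch fps_X (fps_const p) (Suc (Suc d)) =
        gauss_series p (Suc d) * (1 - fps_X * fps_const p ^ Suc d) * qpoch fps_X (fps_const p) (Suc d)"
      by (subst qpoch_Suc) (simp only: mult_ac)
    ultimately have "gauss_series p (Suc d) * qpoch fps_X (fps_const p) (Suc (Suc d)) =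
        gauss_series p d * qpoch fps_X (fps_const p) (Suc d)" by (simp only:)
    with Suc.IH show ?case by simp
  qed
qed

lemma qpoch_inf_shift:
  assumes p: "0 < p" "p < 1"
  shows "qpoch_inf (fps_const (p ^ (k + 1)) * fps_X) p = gauss_series p k * qpoch_inf fps_X p"
proof -
  have "qpoch_inf fps_X p =
        qpoch fps_X (fps_const p) (Suc k) * qpoch_inf (fps_const (p ^ (k + 1)) * fps_X) p"
    using qpoch_inf_split[of p fps_X "k + 1"] p by simp
  thus ?thesis using gauss_series_mult_qpoch[OF p, of k] by (simp flip: mult.assoc)
qed

lemma suminf_fps_nth:
  fixes f :: "nat \<Rightarrow> real fps"
  assumes zero: "\<And>k m. m < k \<Longrightarrow> fps_nth (f k) m = 0"
  shows "fps_nth (\<Sum>k. f k) m = (\<Sum>k\<le>m. fps_nth (f k) m)"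
proof -
  have "(\<lambda>n. \<Sum>k<n. f k) \<longlonglongrightarrow> Abs_fps (\<lambda>m. \<Sum>k\<le>m. fps_nth (f k) m)"
  proof (rule tendsto_fpsI)
    fix m
    have "fps_nth (\<Sum>k<n. f k) m = (\<Sum>k\<le>m. fps_nth (f k) m)" if "n \<ge> Suc m" for n
      unfolding fps_sum_nth using that by (intro sum.mono_neutral_right ballI zero) auto
    thus "\<forall>\<^sub>F n in sequentially. fps_nth (\<Sum>k<n. f k) m =
            fps_nth (Abs_fps (\<lambda>m. \<Sum>k\<le>m. fps_nth (f k) m)) m"
      by (intro eventually_sequentiallyI[of "Suc m"]) simp
  qed
  hence "(\<Sum>k. f k) = Abs_fps (\<lambda>m. \<Sum>k\<le>m. fps_nth (f k) m)"
    by (simp add: sums_def sums_unique[symmetric])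
  thus ?thesis by simp
qed

text \<open>
  For \<open>k \<ge> 1\<close>, the double series \<open>\<Sum>m d. H m d * X^(m + k * d)\<close>. The bound \<open>d \<le> N\<close> follows from \<open>k * d \<le> N\<close> for \<open>k \<ge> 1\<close>
  and only serves to keep the index set finite for \<open>k = 0\<close>.
\<close>
definition diag_series :: "(nat \<Rightarrow> nat \<Rightarrow> real) \<Rightarrow> nat \<Rightarrow> real fps" where
  "diag_series H k = Abs_fps (\<lambda>N. \<Sum>d | d \<le> N \<and> k * d \<le> N. H (N - k * d) d)"

text \<open>
  Writing \<open>d = e + j\<close>, the monomial \<open>X^(m + k * d)\<close> is the product of
  \<open>X^((m - e) + (k + 1) * e)\<close> and \<open>X^(k * j)\<close>.
\<close>
lemma diag_series_convolution:
  assumes k: "k \<ge> 1"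
    and H': "\<And>m d. H' m d = (\<Sum>e | e \<le> m \<and> e \<le> d. H (m - e) e / qpoch p p (d - e))"
  shows "diag_series H' k = euler_series p k * diag_series H (k + 1)"
proof (rule fps_ext)
  fix N
  have le: "d \<le> N" if "k * d \<le> N" for d N
    using that k by (metis le_trans mult_le_mono1 nat_mult_1)
  have "fps_nth (diag_series H' k) N =
      (\<Sum>(d, e) \<in> (SIGMA d:{d. d \<le> N \<and> k * d \<le> N}. {e. e \<le> N - k * d \<and> e \<le> d}).
        H (N - k * d - e) e / qpoch p p (d - e))"
    by (simp add: diag_series_def H' sum.Sigma)
  also have "\<dots> = (\<Sum>(j, e) \<in> (SIGMA j:{j. j \<le> N \<and> k * j \<le> N}. {e. e \<le> N - k * j \<and> (k + 1) * e \<le> N - k * j}).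
        1 / qpoch p p j * H (N - k * j - (k + 1) * e) e)"
  proof (rule sum.reindex_bij_witness[where i = "\<lambda>(j, e). (j + e, e)" and j = "\<lambda>(d, e). (d - e, e)"])
    fix x assume "x \<in> (SIGMA j:{j. j \<le> N \<and> k * j \<le> N}. {e. e \<le> N - k * j \<and> (k + 1) * e \<le> N - k * j})"
    thus "(case x of (j, e) \<Rightarrow> (j + e, e)) \<in> (SIGMA d:{d. d \<le> N \<and> k * d \<le> N}. {e. e \<le> N - k * d \<and> e \<le> d})"
      using le[of "fst x + snd x"] by (auto simp: algebra_simps)
  next
    fix x assume x: "x \<in> (SIGMA d:{d. d \<le> N \<and> k * d \<le> N}. {e. e \<le> N - k * d \<and> e \<le> d})"
    then obtain d e j where de: "x = (d, e)" "d = e + j" by (auto simp: le_iff_add)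
    show "(case x of (d, e) \<Rightarrow> (d - e, e)) \<in> (SIGMA j:{j. j \<le> N \<and> k * j \<le> N}. {e. e \<le> N - k * j \<and> (k + 1) * e \<le> N - k * j})"
      using x le[of j] by (auto simp: de algebra_simps)
    show "(case case x of (d, e) \<Rightarrow> (d - e, e) of (j, e) \<Rightarrow> 1 / qpoch p p j * H (N - k * j - (k + 1) * e) e) =
          (case x of (d, e) \<Rightarrow> H (N - k * d - e) e / qpoch p p (d - e))"
      using x by (auto simp: de algebra_simps)
  qed auto
  also have "\<dots> = (\<Sum>j | j \<le> N \<and> k * j \<le> N. 1 / qpoch p p j * fps_nth (diag_series H (k + 1)) (N - k * j))"
    by (simp add: diag_series_def sum.Sigma sum_distrib_left)
  also have "\<dots> = (\<Sum>i\<in>(\<lambda>j. k * j) ` {j. j \<le> N \<and> k * j \<le> N}.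
      fps_nth (euler_series p k) i * fps_nth (diag_series H (k + 1)) (N - i))"
    using k by (subst sum.reindex) (auto simp: inj_on_def euler_series_def)
  also have "\<dots> = fps_nth (euler_series p k * diag_series H (k + 1)) N"
    unfolding fps_mult_nth
    using le by (intro sum.mono_neutral_left) (auto simp: euler_series_def elim!: dvdE)
  finally show "fps_nth (diag_series H' k) N = fps_nth (euler_series p k * diag_series H (k + 1)) N" .
qed

text \<open>
  Here \<open>H\<close> is the normalized count of matrices of given rank and corank. The infinite sum is reduced
  to finite sums coefficient by coefficient: the term with index \<open>k\<close> is divisible by \<open>X^k\<close>.
\<close>
lemma suminf_eq_diag_series:
  assumes p: "0 < p" "p < 1"
    and H: "\<And>m d. H m d = p ^ (d\<^sup>2) * qpoch p p (m + d) / ((qpoch p p d)\<^sup>2 * qpoch p p m)"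
  shows "(\<Sum>k. fps_const (p ^ (k ^ 2) / qpoch p p k) * fps_X ^ ((b + 1) * k) *
               qpoch_inf (fps_const (p ^ (k + 1)) * fps_X) p) =
         qpoch_inf fps_X p * diag_series H (b + 1)"
proof (rule fps_ext)
  fix N
  let ?f = "\<lambda>k. fps_const (p ^ (k ^ 2) / qpoch p p k) * fps_X ^ ((b + 1) * k) *
               qpoch_inf (fps_const (p ^ (k + 1)) * fps_X) p"
  define g where "g k = fps_const (p ^ (k ^ 2) / qpoch p p k) * (fps_X ^ ((b + 1) * k) * gauss_series p k)" for k
  have g_nth: "fps_nth (g k) m = (if (b + 1) * k \<le> m then H (m - (b + 1) * k) k else 0)" for k m
    unfolding g_def by (auto simp: fps_X_power_mult_nth gauss_series_def H power2_eq_square)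
  have le: "k \<le> m" if "(b + 1) * k \<le> m" for k m :: nat
    using that by (metis add.commute le_add1 le_trans mult_le_mono1 nat_mult_1 plus_1_eq_Suc)
  have f_eq: "?f k = qpoch_inf fps_X p * g k" for k
    unfolding qpoch_inf_shift[OF p] g_def by (simp add: mult_ac)
  have diag_nth: "fps_nth (diag_series H (b + 1)) m = fps_nth (\<Sum>k\<le>N. g k) m" if "m \<le> N" for m
  proof -
    have "fps_nth (\<Sum>k\<le>N. g k) m = (\<Sum>k | k \<le> m \<and> (b + 1) * k \<le> m. fps_nth (g k) m)"
      unfolding fps_sum_nth using le that
      by (intro sum.mono_neutral_right) (auto simp: g_nth)
    thus ?thesis by (simp add: diag_series_def g_nth)
  qed
  have "fps_nth (\<Sum>k. ?f k) N = (\<Sum>k\<le>N. fps_nth (?f k) N)"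
  proof (rule suminf_fps_nth)
    fix k m :: nat assume "m < k"
    hence "m < (b + 1) * k" using le by (meson leI le_less_trans less_irrefl)
    thus "fps_nth (?f k) m = 0" by (simp add: mult.assoc fps_X_power_mult_nth)
  qed
  also have "\<dots> = fps_nth (qpoch_inf fps_X p * (\<Sum>k\<le>N. g k)) N"
    by (simp only: f_eq sum_distrib_left fps_sum_nth)
  also have "\<dots> = fps_nth (qpoch_inf fps_X p * diag_series H (b + 1)) N"
    unfolding fps_mult_nth by (intro sum.cong) (simp_all add: diag_nth[simplified])
  finally show "fps_nth (\<Sum>k. ?f k) N = fps_nth (qpoch_inf fps_X p * diag_series H (b + 1)) N" .
qed

section \<open>Normalized counts and the generating function\<close>

lemma card_left_invertible_qpoch:
  fixes p :: real
  assumes p: "p = 1 / real CARD('a)"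
  shows "real (card (left_invertible n m :: 'a::{field,finite} mat set)) =
    (if m \<le> n then real CARD('a) ^ (n * m) * qpoch p p n / qpoch p p (n - m) else 0)"
proof -
  define q where "q = real CARD('a)"
  have q: "q \<ge> 2" and pq: "p = 1 / q" using two_le_card_field[where ?'a = 'a] p by (simp_all add: q_def)
  have p01: "0 < p" "p < 1" using q by (simp_all add: pq)
  have c: "qpoch p p k > 0" for k by (rule qpoch_pos) (use p01 in auto)
  show ?thesis
  proof (cases "m \<le> n")
    case True
    have "(\<Prod>i<m. q ^ n - q ^ i) = q ^ (n * m) * qpoch p p n / qpoch p p (n - m)"
      using True
    proof (induction m)
      case 0
      show ?case using c[of n] by simp
    next
      case (Suc m)
      define d where "d = n - Suc m"
      have d: "n - m = Suc d" "n = m + Suc d" using Suc.prems by (simp_all add: d_def)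
      have "q ^ n - q ^ m = q ^ n * (1 - p * p ^ d)"
        using q by (simp add: d(2) pq power_add field_simps)
      moreover have "1 - p * p ^ d \<noteq> 0" using c[of d] c[of "Suc d"] by (auto simp: qpoch_Suc)
      moreover have "(\<Prod>i<Suc m. q ^ n - q ^ i) =
          q ^ (n * m) * qpoch p p n / (qpoch p p d * (1 - p * p ^ d)) * (q ^ n - q ^ m)"
        using Suc by (simp add: d(1) qpoch_Suc)
      ultimately show ?case by (simp add: d_def[symmetric] power_add)
    qed
    thus ?thesis using True by (simp add: card_left_invertible q_def)
  next
    case False
    hence "(\<Prod>i<m. q ^ n - q ^ i) = 0" by (intro prod_zero) auto
    thus ?thesis using False by (simp add: card_left_invertible q_def)
  qed
qed

text \<open>
  The normalized number of pairs of size \<open>m + d\<close> whose first component has rank \<open>m\<close>, and hence a kernel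
  of dimension \<open>d\<close>. Indexing by rank and corank instead of size and rank makes the recursion a
  convolution.
\<close>
definition rank_weight :: "'a::{field,finite} itself \<Rightarrow> nat \<Rightarrow> nat \<Rightarrow> nat \<Rightarrow> real" where
  "rank_weight T b m d =
     real (rank_count T b (m + d) m) / real (card (GL_mat (m + d) :: 'a mat set))"

lemma rank_weight_recursion:
  fixes p :: real
  assumes p: "p = 1 / real CARD('a::{field,finite})"
  shows "rank_weight TYPE('a) 0 m d =
           p ^ (d\<^sup>2) * qpoch p p (m + d) / ((qpoch p p d)\<^sup>2 * qpoch p p m)"
    and "rank_weight TYPE('a) (Suc b) m d =
           (\<Sum>e | e \<le> m \<and> e \<le> d. rank_weight TYPE('a) b (m - e) e / qpoch p p (d - e))"
proof -
  define q where "q = real CARD('a)"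
  have q: "q \<ge> 2" and pq: "p = 1 / q" using two_le_card_field[where ?'a = 'a] p by (simp_all add: q_def)
  have p01: "0 < p" "p < 1" using q by (simp_all add: pq)
  have c: "qpoch p p k > 0" for k by (rule qpoch_pos) (use p01 in auto)
  have c': "qpoch p p k \<noteq> 0" for k using c[of k] by simp
  define I where "I n m = real (card (left_invertible n m :: 'a mat set))" for n m
  have I: "I n m = (if m \<le> n then q ^ (n * m) * qpoch p p n / qpoch p p (n - m) else 0)" for n m
    unfolding I_def q_def by (rule card_left_invertible_qpoch[OF p])
  have GL: "real (card (GL_mat n :: 'a mat set)) = q ^ (n * n) * qpoch p p n" for n
    using I[of n n] by (simp add: GL_mat_eq I_def)
  let ?n = "m + d"
  have "I m m * rank_count TYPE('a) 0 ?n m = I ?n m * I ?n m"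
    using arg_cong[OF rank_count_0[where ?'a='a, of m ?n], of real] by (simp add: I_def)
  hence "rank_count TYPE('a) 0 ?n m = I ?n m * I ?n m / (q ^ (m * m) * qpoch p p m)"
    using q c' by (simp add: I field_simps)
  hence "rank_weight TYPE('a) 0 m d =
      (q ^ (?n * m) * q ^ (?n * m) / (q ^ (m * m) * q ^ (?n * ?n))) *
      (qpoch p p ?n / ((qpoch p p d)\<^sup>2 * qpoch p p m))"
    using c'[of ?n] by (simp add: rank_weight_def GL I power2_eq_square mult_ac)
  also have "q ^ (?n * m) * q ^ (?n * m) / (q ^ (m * m) * q ^ (?n * ?n)) = p ^ (d\<^sup>2)"
    using q by (simp add: pq power2_eq_square field_simps flip: power_add)
  finally show "rank_weight TYPE('a) 0 m d =
           p ^ (d\<^sup>2) * qpoch p p (m + d) / ((qpoch p p d)\<^sup>2 * qpoch p p m)" by simp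
  let ?S = "\<Sum>e | e \<le> m \<and> e \<le> d. rank_weight TYPE('a) b (m - e) e / qpoch p p (d - e)"
  have "(\<Sum>r\<le>m. q ^ (r * d) * I d (m - r) * rank_count TYPE('a) b m r) =
        (\<Sum>e\<le>m. q ^ ((m - e) * d) * I d e * rank_count TYPE('a) b m (m - e))"
    by (rule sum.reindex_bij_witness[where i = "\<lambda>e. m - e" and j = "\<lambda>r. m - r"]) auto
  also have "\<dots> = (\<Sum>e | e \<le> m \<and> e \<le> d. q ^ ((m - e) * d) * I d e * rank_count TYPE('a) b m (m - e))"
    by (rule sum.mono_neutral_right) (auto simp: I)
  also have "\<dots> = (\<Sum>e | e \<le> m \<and> e \<le> d.
      I m m * q ^ (m * d) * qpoch p p d * (rank_weight TYPE('a) b (m - e) e / qpoch p p (d - e)))"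
  proof (rule sum.cong[OF refl])
    fix e assume "e \<in> {e. e \<le> m \<and> e \<le> d}"
    hence e: "e \<le> m" "e \<le> d" by auto
    have "(m - e) * d + d * e = m * d"
      using e by (metis add_mult_distrib le_add_diff_inverse2 mult.commute)
    hence "q ^ ((m - e) * d) * q ^ (d * e) = q ^ (m * d)" by (metis power_add)
    hence "q ^ ((m - e) * d) * I d e = q ^ (m * d) * qpoch p p d / qpoch p p (d - e)"
      using e by (simp add: I)
    moreover have "rank_count TYPE('a) b m (m - e) = I m m * rank_weight TYPE('a) b (m - e) e"
      using e q c' by (simp add: rank_weight_def GL I)
    ultimately show "q ^ ((m - e) * d) * I d e * rank_count TYPE('a) b m (m - e) =
      I m m * q ^ (m * d) * qpoch p p d * (rank_weight TYPE('a) b (m - e) e / qpoch p p (d - e))"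
      by simp
  qed
  also have "\<dots> = I m m * q ^ (m * d) * qpoch p p d * ?S"
    by (simp only: sum_distrib_left)
  finally have sum_eq: "(\<Sum>r\<le>m. q ^ (r * d) * I d (m - r) * rank_count TYPE('a) b m r) =
    I m m * q ^ (m * d) * qpoch p p d * ?S" .
  have "I m m * rank_count TYPE('a) (Suc b) ?n m = 
      I ?n m * (q ^ (d\<^sup>2) * (\<Sum>r\<le>m. q ^ (r * d) * I d (m - r) * rank_count TYPE('a) b m r))"
    using arg_cong[OF rank_count_Suc[where ?'a='a, of m b ?n], of real] by (simp add: I_def q_def)
  hence "I m m * rank_count TYPE('a) (Suc b) ?n m =
      I m m * (I ?n m * q ^ (d\<^sup>2) * q ^ (m * d) * qpoch p p d * ?S)"
    unfolding sum_eq by (simp only: mult_ac)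
  moreover have "I m m \<noteq> 0" using q c' by (simp add: I)
  ultimately have "rank_count TYPE('a) (Suc b) ?n m = I ?n m * q ^ (d\<^sup>2) * q ^ (m * d) * qpoch p p d * ?S"
    by simp
  hence "rank_weight TYPE('a) (Suc b) m d =
      q ^ (?n * m) * q ^ (d\<^sup>2) * q ^ (m * d) / q ^ (?n * ?n) * ?S"
    using c' by (simp add: rank_weight_def GL I)
  also have "q ^ (?n * m) * q ^ (d\<^sup>2) * q ^ (m * d) / q ^ (?n * ?n) = 1"
    using q by (simp add: power2_eq_square algebra_simps flip: power_add)
  finally show "rank_weight TYPE('a) (Suc b) m d = ?S" by simp
qed

lemma diag_series_rank_weight:
  fixes p :: real
  assumes p: "p = 1 / real CARD('a::{field,finite})" and k: "k \<ge> 1"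
  shows "diag_series (rank_weight TYPE('a) b) k =
         (\<Prod>i=k..<k+b. euler_series p i) * diag_series (rank_weight TYPE('a) 0) (k + b)"
  using k
proof (induction b arbitrary: k)
  case (Suc b)
  have "diag_series (rank_weight TYPE('a) (Suc b)) k =
        euler_series p k * diag_series (rank_weight TYPE('a) b) (k + 1)"
    using rank_weight_recursion(2)[OF p] Suc.prems by (intro diag_series_convolution) auto
  also have "\<dots> = euler_series p k * (\<Prod>i=Suc k..<k + Suc b. euler_series p i) *
      diag_series (rank_weight TYPE('a) 0) (k + Suc b)"
    using Suc.IH[of "k + 1"] by (simp add: mult.assoc)
  also have "euler_series p k * (\<Prod>i=Suc k..<k + Suc b. euler_series p i) =
      (\<Prod>i=k..<k + Suc b. euler_series p i)"
    by (simp add: prod.atLeast_Suc_lessThan)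
  finally show ?case .
qed simp

theorem theorem1p2:
  fixes q b :: nat and p :: real
  assumes "primepow q"
    and "CARD('a::{field,finite}) = q"
    and "b \<ge> 1"
    and "p = 1 / real q"
  shows "Abs_fps (\<lambda>n. real (card (commuting_nil_pairs b n :: ('a mat \<times> 'a mat) set)) /
                       real (card (GL_mat n :: 'a mat set))) =
         1 / (qpoch_inf fps_X p * (\<Prod>i=1..b. qpoch_inf (fps_X ^ i) p)) *
         (\<Sum>k. fps_const (p ^ (k ^ 2) / qpoch p p k) * fps_X ^ ((b + 1) * k) *
               qpoch_inf (fps_const (p ^ (k + 1)) * fps_X) p)"
proof -
  have p: "p = 1 / real CARD('a)" using assms by simp
  hence p01: "0 < p" "p < 1" using two_le_card_field[where ?'a = 'a] by simp_all
  let ?H = "rank_weight TYPE('a)"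
  let ?D = "\<Prod>i=1..b. qpoch_inf (fps_X ^ i) p"
  have "Abs_fps (\<lambda>n. real (card (commuting_nil_pairs b n :: ('a mat \<times> 'a mat) set)) /
                       real (card (GL_mat n :: 'a mat set))) = diag_series (?H b) 1"
  proof (rule fps_ext)
    fix n
    have "real (card (commuting_nil_pairs b n :: ('a mat \<times> 'a mat) set)) / real (card (GL_mat n :: 'a mat set)) =
          (\<Sum>m\<le>n. ?H b m (n - m))"
      by (simp add: card_commuting_nil_pairs rank_weight_def sum_divide_distrib)
    also have "\<dots> = (\<Sum>d\<le>n. ?H b (n - d) d)"
      by (rule sum.reindex_bij_witness[where i = "\<lambda>d. n - d" and j = "\<lambda>m. n - m"]) auto
    also have "{..n} = {d. d \<le> n \<and> 1 * d \<le> n}" by auto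
    finally show "fps_nth (Abs_fps (\<lambda>n. real (card (commuting_nil_pairs b n :: ('a mat \<times> 'a mat) set)) /
                       real (card (GL_mat n :: 'a mat set)))) n = fps_nth (diag_series (?H b) 1) n"
      by (simp add: diag_series_def)
  qed
  also have "\<dots> = (\<Prod>i=1..b. euler_series p i) * diag_series (?H 0) (b + 1)"
    using diag_series_rank_weight[OF p, of 1 b]
    by (simp add: atLeastLessThanSuc_atLeastAtMost)
  also have "\<dots> = 1 / (qpoch_inf fps_X p * ?D) * (qpoch_inf fps_X p * diag_series (?H 0) (b + 1))"
  proof -
    let ?Q = "qpoch_inf fps_X p" and ?E = "\<Prod>i=1..b. euler_series p i"
    have ED: "?E * ?D = 1"
      unfolding prod.distrib[symmetric]
      using euler_series_mult_qpoch_inf[OF p01] by (intro prod.neutral) auto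
    have EQ: "euler_series p 1 * ?Q = 1"
      using euler_series_mult_qpoch_inf[OF p01, of 1] by simp
    have "(euler_series p 1 * ?E) * (?Q * ?D) = (euler_series p 1 * ?Q) * (?E * ?D)"
      by (simp only: mult_ac)
    hence inv: "(euler_series p 1 * ?E) * (?Q * ?D) = 1" unfolding ED EQ by simp
    hence "?Q * ?D \<noteq> 0" by (metis mult_zero_right zero_neq_one)
    hence "1 / (?Q * ?D) = euler_series p 1 * ?E"
      using inv by (metis nonzero_mult_div_cancel_right)
    hence "1 / (?Q * ?D) * (?Q * diag_series (?H 0) (b + 1)) =
        (euler_series p 1 * ?Q) * (?E * diag_series (?H 0) (b + 1))" 
      by (simp only: mult_ac)
    thus ?thesis unfolding EQ by (simp only: mult_1_left)
  qed
  also have "qpoch_inf fps_X p * diag_series (?H 0) (b + 1) =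
      (\<Sum>k. fps_const (p ^ (k ^ 2) / qpoch p p k) * fps_X ^ ((b + 1) * k) *
               qpoch_inf (fps_const (p ^ (k + 1)) * fps_X) p)"
    by (rule suminf_eq_diag_series[OF p01 rank_weight_recursion(1)[OF p], symmetric])
  finally show ?thesis .
qed

end
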